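(* Let $\phi:\mathbb{R}^n\to\mathbb{R}$ be convex and $1/\gamma$ smooth, let $g:\mathbb{R}^m\to\mathbb{R}\cup\{+\infty\}$ be convex and $\lambda$ strongly convex (with $\gamma,\lambda>0$), and let $A\in\mathbb{R}^{p\times n}$, $B\in\mathbb{R}^{p\times m}$, $c\in\mathbb{R}^p$, $\rho>0$. Let $G\in\mathbb{R}^{m\times m}$ and $H\in\mathbb{R}^{n\times n}$ be symmetric positive semi-definite, and assume that $H=A^\top\tilde H A$ for a symmetric positive semi-definite matrix $\tilde H\in\mathbb{R}^{p\times p}$. Let $\sigma_{\max}(H)$ and $\sigma_{\max}(\tilde H)$ be the largest eigenvalues of $H$ and $\tilde H$, let $\sigma_{\min}(A)$ be the smallest eigenvalue of $(AA^\top)^{1/2}$, and let $\sigma_{\max}(B)$, $\sigma_{\max}(G)$ be the largest singular values of $B$ and $G$. Let $s\in[0,1)$ and $\theta>0$ satisfy $$\theta\le\min\left(\frac{\gamma\rho\,\sigma_{\min}(A)^2}{\gamma\sigma_{\max}(H)+1},\ \frac{s\rho}{\sigma_{\max}(\tilde H)},\ \frac{(1-s)\lambda}{(\rho+\sigma_{\max}(\tilde H))\sigma_{\max}(B)^2+(1-s)\rho\,\sigma_{\max}(G)}\right).$$ Let $(v^t,w^t,\alpha^t)_{t\ge 1}$ be generated from arbitrary $w^0\in\mathbb{R}^n$, $v^0\in\mathbb{R}^m$, $\alpha^0\in\mathbb{R}^p$ by the preconditioned standard ADMM algorithm (defined in the context), and let $\tilde\alpha^t=\alpha^t+\tilde H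 A(w^t-w^{t-1})$ for $t\ge1$. Then for all $(\alpha,v)\in\mathbb{R}^p\times\mathbb{R}^m$ and $w=\nabla\phi^*(-A^\top\alpha)$, and every $T\ge 1$, $$\sum_{t=1}^T(1+\theta)^{t-T}r_t\le(1+\theta)^{-T}\delta_0-\delta_T,\qquad \sum_{t=1}^T(1+\theta)^{t-T}r_t^*\le(1+\theta)^{-T}\delta_0-\delta_T,$$ where $$r_t=\phi(w^t)+g(v^t)-\phi(w)-g(v)-(\tilde\alpha^t)^\top(Aw-Bv-c)+\alpha^\top(Aw^t-Bv^t-c),$$ $$r_t^*=\phi^*(-A^\top\tilde\alpha^t)+g(v^t)-\phi^*(-A^\top\alpha)-g(v)+(\tilde\alpha^t)^\top(Bv+c)-\alpha^\top(Bv^t+c),$$ $$\delta_t=\frac{\rho}{2}\|Aw^t-Bv-c\|_2^2+\frac12\|Aw^t-Bv-c\|_{\tilde H}^2+\frac{\rho(1+\theta)}{2}\|v^t-v\|_G^2+\frac{1+\theta}{2\rho}\|\alpha-\alpha^t\|_2^2.$$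
   Context: For a symmetric positive semi-definite matrix $M$, $\|x\|_M^2=x^\top Mx$. The problem is $\min_{w,v}[\phi(w)+g(v)]$ subject to $Aw-Bv=c$. Preconditioned standard ADMM: given $w^0,v^0,\alpha^0$, for $t=1,2,\ldots$, $$v^t=\arg\min_v\Big[g(v)-(\alpha^{t-1})^\top Bv+\tfrac{\rho}{2}\|Aw^{t-1}-Bv-c\|_2^2+\tfrac{\rho}{2}\|v-v^{t-1}\|_G^2\Big],$$ $$w^t=\arg\min_w\Big[\phi(w)+(\alpha^{t-1})^\top Aw+\tfrac{\rho}{2}\|Aw-Bv^t-c\|_2^2+\tfrac12\|w-w^{t-1}\|_H^2\Big],$$ $$\alpha^t=\alpha^{t-1}+\rho(Aw^t-Bv^t-c).$$ The minimizers are assumed to exist (any minimizer may be taken). For a convex function $h$, $h^*(\beta)=\sup_u[\beta^\top u-h(u)]$ is the convex conjugate, and $D_h(u',u)=h(u)-h(u')-\nabla h(u')^\top(u-u')$ is the Bregman divergence. "$\phi$ is $1/\gamma$ smooth" means $\phi$ is differentiable with $D_\phi(w',w)\le\frac{1}{2\gamma}\|w'-w\|_2^2$ for all $w,w'$. "$g$ is $\lambda$ strongly convex" means $D_g(v',v)\ge\frac{\lambda}{2}\|v'-v\|_2^2$ for all $v,v'$; $g$ may be nondifferentiable or take the value $+\infty$ (but is not identically $+\infty$), in which case $\nabla g(v')$ stands for any subgradient at $v'$. Likewise $w=\nabla\phi^*(-A^\top\alpha)$ means that $w$ is a (sub)gradient of $\phi^*$ at $-A^\top\alpha$, equivalently $\nabla\phi(w)=-A^\top\alpha$;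 the claim is for those $\alpha$ for which such a $w$ exists. A fraction with positive numerator or $s\rho$ as numerator and zero denominator in the bound on $\theta$ is read as $+\infty$ (e.g. the second term when $\tilde H=0$). *)

theory Defs
  imports "HOL-Analysis.Analysis"
begin

section \<open>Matrices\<close>

definition pos_semidef :: "real^'n^'n \<Rightarrow> bool" where
  "pos_semidef M \<longleftrightarrow> transpose M = M \<and> (\<forall>x. 0 \<le> x \<bullet> (M *v x))"

definition norm_sq_wrt :: "real^'n^'n \<Rightarrow> real^'n \<Rightarrow> real" where
  "norm_sq_wrt M x = x \<bullet> (M *v x)"

definition eigenvalues :: "real^'n^'n \<Rightarrow> real set" where
  "eigenvalues M = {l. \<exists>x. x \<noteq> 0 \<and> M *v x = l *\<^sub>R x}"

text \<open>The following two are meaningful for symmetric matrices, whose set of (real)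
  eigenvalues is finite and nonempty.\<close>

definition max_eigenvalue :: "real^'n^'n \<Rightarrow> real" where
  "max_eigenvalue M = Max (eigenvalues M)"

definition min_eigenvalue :: "real^'n^'n \<Rightarrow> real" where
  "min_eigenvalue M = Min (eigenvalues M)"

definition psd_sqrt :: "real^'n^'n \<Rightarrow> real^'n^'n" where
  "psd_sqrt M = (THE R. pos_semidef R \<and> R ** R = M)"

definition max_singular_value :: "real^'m^'p \<Rightarrow> real" where
  "max_singular_value B = Max (sqrt ` eigenvalues (transpose B ** B))"

text \<open>Smallest eigenvalue of the square root of \<open>A A\<^sup>T\<close> (and not of \<open>A\<^sup>T A\<close>): it is
  positive only if \<open>A\<close> has full row rank.\<close>

definition sigma_min :: "real^'n^'p \<Rightarrow> real" where
  "sigma_min A = min_eigenvalue (psd_sqrt (A ** transpose A))"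

section \<open>Extended-real-valued convex functions\<close>

text \<open>Functions into \<open>\<real> \<union> {+\<infinity>}\<close> that are not identically \<open>+\<infinity>\<close>.\<close>

definition proper_fun :: "('a \<Rightarrow> ereal) \<Rightarrow> bool" where
  "proper_fun h \<longleftrightarrow> (\<forall>x. h x \<noteq> -\<infinity>) \<and> (\<exists>x. h x \<noteq> \<infinity>)"

text \<open>Convexity is convexity of the epigraph; the library's \<open>epigraph\<close> and \<open>convex_on\<close> are
  restricted to real-valued functions.\<close>

definition convex_ereal :: "('a::real_vector \<Rightarrow> ereal) \<Rightarrow> bool" where
  "convex_ereal h \<longleftrightarrow> convex {(x, r::real). h x \<le> ereal r}"

definition subdifferential :: "('a::real_inner \<Rightarrow> ereal) \<Rightarrow> 'a \<Rightarrow> 'a set" where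
  "subdifferential h x =
     {d. \<bar>h x\<bar> \<noteq> \<infinity> \<and> (\<forall>y. h x + ereal (d \<bullet> (y - x)) \<le> h y)}"

definition conjugate :: "('a::real_inner \<Rightarrow> ereal) \<Rightarrow> 'a \<Rightarrow> ereal" where
  "conjugate h \<beta> = (SUP u. ereal (\<beta> \<bullet> u) - h u)"

text \<open>\<open>bregman h d x' x\<close> is \<open>D\<^sub>h(x', x)\<close>, where \<open>d\<close> is the chosen (sub)gradient of \<open>h\<close> at the
  first argument \<open>x'\<close>, at which \<open>h\<close> is finite.\<close>

definition bregman :: "('a::real_inner \<Rightarrow> ereal) \<Rightarrow> 'a \<Rightarrow> 'a \<Rightarrow> 'a \<Rightarrow> ereal" where
  "bregman h d x' x = h x - h x' - ereal (d \<bullet> (x - x'))"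

text \<open>\<open>L\<close>-smoothness; it is used with \<open>L = 1/\<gamma>\<close>.\<close>

definition smooth_fun :: "real \<Rightarrow> ('a::real_inner \<Rightarrow> real) \<Rightarrow> bool" where
  "smooth_fun L f \<longleftrightarrow>
     (\<forall>x. \<exists>d. GDERIV f x :> d) \<and>
     (\<forall>x' x d. (GDERIV f x' :> d) \<longrightarrow>
        bregman (\<lambda>y. ereal (f y)) d x' x \<le> ereal (L / 2 * (norm (x' - x))\<^sup>2))"

definition strongly_convex :: "real \<Rightarrow> ('a::real_inner \<Rightarrow> ereal) \<Rightarrow> bool" where
  "strongly_convex l h \<longleftrightarrow>
     (\<forall>x' x. \<forall>d \<in> subdifferential h x'.
        ereal (l / 2 * (norm (x' - x))\<^sup>2) \<le> bregman h d x' x)"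

section \<open>Preconditioned standard ADMM\<close>

text \<open>The sequences \<open>vs\<close>, \<open>ws\<close>, \<open>\<alpha>s\<close> are the iterates \<open>v\<^sup>t\<close>, \<open>w\<^sup>t\<close>, \<open>\<alpha>\<^sup>t\<close>; their values at \<open>0\<close>
  are the arbitrary starting point.\<close>

definition admm ::
  "(real^'n \<Rightarrow> real) \<Rightarrow> (real^'m \<Rightarrow> ereal) \<Rightarrow> real^'n^'p \<Rightarrow> real^'m^'p \<Rightarrow> real^'p \<Rightarrow>
   real \<Rightarrow> real^'m^'m \<Rightarrow> real^'n^'n \<Rightarrow>
   (nat \<Rightarrow> real^'m) \<Rightarrow> (nat \<Rightarrow> real^'n) \<Rightarrow> (nat \<Rightarrow> real^'p) \<Rightarrow> bool" where
  "admm \<phi> g A B c \<rho> G H vs ws \<alpha>s \<longleftrightarrow>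
    (\<forall>t\<ge>1.
      is_arg_min
        (\<lambda>v. g v + ereal (- (\<alpha>s (t - 1) \<bullet> (B *v v))
                 + \<rho> / 2 * (norm (A *v ws (t - 1) - B *v v - c))\<^sup>2
                 + \<rho> / 2 * norm_sq_wrt G (v - vs (t - 1))))
        (\<lambda>_. True) (vs t) \<and>
      is_arg_min
        (\<lambda>w. \<phi> w + \<alpha>s (t - 1) \<bullet> (A *v w)
               + \<rho> / 2 * (norm (A *v w - B *v vs t - c))\<^sup>2
               + 1 / 2 * norm_sq_wrt H (w - ws (t - 1)))
        (\<lambda>_. True) (ws t) \<and>
      \<alpha>s t = \<alpha>s (t - 1) + \<rho> *\<^sub>R (A *v ws t - B *v vs t - c))"

text \<open>Quotients in the step-size bound: a zero denominator gives \<open>+\<infinity>\<close>, even when the numerator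
  is zero (unlike division on \<open>ereal\<close>, where \<open>0 / 0 = 0\<close>).\<close>

definition quot_or_top :: "real \<Rightarrow> real \<Rightarrow> ereal" where
  "quot_or_top a b = (if b = 0 then \<infinity> else ereal (a / b))"

end

theory Submission
  imports Defs
begin

text \<open>Optimality of the two updates says \<open>\<nabla>\<phi>(w\<^sup>t) = -A\<^sup>T \<alpha>t\<close>, where \<open>\<alpha>t\<close> is the shifted dual variable
  \<open>\<alpha>\<^sup>t + Ht A (w\<^sup>t - w\<^sup>t\<^sup>-\<^sup>1)\<close>, and produces a subgradient of \<open>g\<close> at \<open>v\<^sup>t\<close>. Hence both gaps are equal,
  up to exchanging the arguments of the Bregman divergence of \<open>\<phi>\<close>, to a sum of inner products that
  polarizes into the decrease of the potential \<open>\<delta>\<close> without its factors \<open>1 + \<theta>\<close>, minus squares.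
  These squares, the cocoercivity term \<open>\<gamma>/2 \<parallel>A\<^sup>T(\<alpha>t - \<alpha>)\<parallel>\<^sup>2\<close> and the strong convexity term
  \<open>\<lambda>/2 \<parallel>v\<^sup>t - v\<parallel>\<^sup>2\<close> pay for the contraction factor: the first bound on \<open>\<theta>\<close> handles the dual error,
  the other two handle \<open>A w\<^sup>t\<^sup>-\<^sup>1 - B v - c\<close> and \<open>\<parallel>v\<^sup>t - v\<parallel>\<^sub>G\<close>. This gives
  \<open>r\<^sub>t \<le> \<delta>\<^sub>t\<^sub>-\<^sub>1 / (1 + \<theta>) - \<delta>\<^sub>t\<close>, and likewise for the second gap, which telescopes.\<close>

section \<open>Symmetric matrices\<close>

lemma inner_matrix_left:
  fixes A :: "real^'n^'p"
  shows "(A *v x) \<bullet> y = x \<bullet> (transpose A *v y)"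
  by (metis dot_lmul_matrix inner_commute vector_transpose_matrix)

lemma symmetric_iff:
  fixes M :: "real^'n^'n"
  shows "transpose M = M \<longleftrightarrow> (\<forall>x y. (M *v x) \<bullet> y = x \<bullet> (M *v y))"
proof
  assume "transpose M = M"
  then show "\<forall>x y. (M *v x) \<bullet> y = x \<bullet> (M *v y)"
    by (simp add: inner_matrix_left)
next
  assume "\<forall>x y. (M *v x) \<bullet> y = x \<bullet> (M *v y)"
  then have "x \<bullet> (transpose M *v y) = x \<bullet> (M *v y)" for x y
    by (metis inner_matrix_left)
  then show "transpose M = M"
    by (metis matrix_eq vector_eq_ldot)
qed

text \<open>The quadratic form is nonnegative at \<open>u - t *\<^sub>R f u\<close> for every
  \<open>t\<close>, which is a discriminant condition. It serves twice: a vector at which a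
  semidefinite form vanishes lies in the kernel, and \<open>norm (H *v u)\<close> is controlled by
  \<open>u \<bullet> (H *v u)\<close>.\<close>

lemma norm_sq_le_selfadjoint:
  fixes f :: "'a::real_inner \<Rightarrow> 'a"
  assumes f: "linear f" and S: "subspace S" and inv: "f ` S \<subseteq> S"
    and sa: "\<And>x y. f x \<bullet> y = x \<bullet> f y"
    and pos: "\<And>x. x \<in> S \<Longrightarrow> 0 \<le> x \<bullet> f x"
    and le: "\<And>x. x \<in> S \<Longrightarrow> x \<bullet> f x \<le> l * (norm x)\<^sup>2"
    and u: "u \<in> S"
  shows "(norm (f u))\<^sup>2 \<le> l * (u \<bullet> f u)"
proof -
  have fu: "f u \<in> S" using inv u by auto
  have key: "0 \<le> u \<bullet> f u - 2 * t * (norm (f u))\<^sup>2 + t\<^sup>2 * (l * (norm (f u))\<^sup>2)" for t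
  proof -
    have "u - t *\<^sub>R f u \<in> S"
      using S u fu by (simp add: subspace_diff subspace_scale)
    then have "0 \<le> (u - t *\<^sub>R f u) \<bullet> f (u - t *\<^sub>R f u)" by (rule pos)
    also have "\<dots> = u \<bullet> f u - 2 * t * (norm (f u))\<^sup>2 + t\<^sup>2 * (f u \<bullet> f (f u))"
      using sa[of u "f u"] inner_commute[of "f u" u]
      by (simp add: linear_diff[OF f] linear_scale[OF f] inner_diff power2_norm_eq_inner
          algebra_simps power2_eq_square[of t])
    also have "\<dots> \<le> u \<bullet> f u - 2 * t * (norm (f u))\<^sup>2 + t\<^sup>2 * (l * (norm (f u))\<^sup>2)"
      using le[OF fu] by (simp add: mult_left_mono)
    finally show ?thesis .
  qed
  have q: "0 \<le> u \<bullet> f u" "u \<bullet> f u \<le> l * (norm u)\<^sup>2" using pos le u by auto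
  show ?thesis
  proof (cases "l > 0")
    case True
    \<comment> \<open>\<open>t = 1 / l\<close> minimizes the quadratic in \<open>t\<close>. In the
      other case the form vanishes at \<open>u\<close>, and \<open>t = 1\<close> suffices.\<close>
    have "0 \<le> u \<bullet> f u - (norm (f u))\<^sup>2 / l"
      using key[of "1 / l"] True by (simp add: power2_eq_square field_simps)
    then show ?thesis using True by (simp add: field_simps)
  next
    case False
    then have "l * (norm u)\<^sup>2 \<le> 0" by (simp add: mult_nonpos_nonneg)
    then have z: "u \<bullet> f u = 0" using q by linarith
    have "l * (norm (f u))\<^sup>2 \<le> 0" using False by (simp add: mult_nonpos_nonneg)
    moreover have "2 * (norm (f u))\<^sup>2 \<le> l * (norm (f u))\<^sup>2" using key[of 1] z by simp
    ultimately have "(norm (f u))\<^sup>2 \<le> 0" by linarith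
    then show ?thesis using z by simp
  qed
qed

text \<open>A maximizer of the Rayleigh quotient is an eigenvector.\<close>

lemma extremal_eigenvector:
  fixes f :: "'a::euclidean_space \<Rightarrow> 'a"
  assumes f: "linear f" and S: "subspace S" and inv: "f ` S \<subseteq> S"
    and sa: "\<And>x y. f x \<bullet> y = x \<bullet> f y"
    and ne: "S \<noteq> {0}"
  shows "\<exists>x\<in>S. \<exists>l. norm x = 1 \<and> f x = l *\<^sub>R x \<and> (\<forall>y\<in>S. y \<bullet> f y \<le> l * (norm y)\<^sup>2)"
proof -
  have "0 \<in> S" using S by (rule subspace_0)
  then obtain z where z: "z \<in> S" "z \<noteq> 0" using ne by blast
  let ?K = "sphere 0 1 \<inter> S"
  have "compact ?K"
    by (simp add: compact_Int_closed closed_subspace S)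
  moreover have "z /\<^sub>R norm z \<in> ?K" using z S by (simp add: subspace_scale)
  then have "?K \<noteq> {}" by blast
  moreover have "continuous_on ?K (\<lambda>y. y \<bullet> f y)"
    by (intro continuous_intros linear_continuous_on linear_conv_bounded_linear[THEN iffD1] f)
  ultimately obtain x where x: "x \<in> ?K" and max: "\<And>y. y \<in> ?K \<Longrightarrow> y \<bullet> f y \<le> x \<bullet> f x"
    using continuous_attains_sup[of ?K "\<lambda>y. y \<bullet> f y"] by blast
  define l where "l = x \<bullet> f x"
  have ray: "y \<bullet> f y \<le> l * (norm y)\<^sup>2" if "y \<in> S" for y
  proof (cases "y = 0")
    case False
    then have "y /\<^sub>R norm y \<in> ?K" using S that by (simp add: subspace_scale)
    then have "(y /\<^sub>R norm y) \<bullet> f (y /\<^sub>R norm y) \<le> l" unfolding l_def by (rule max)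
    then have "(y \<bullet> f y) / (norm y)\<^sup>2 \<le> l"
      by (simp add: linear_scale[OF f] power2_eq_square divide_simps)
    then show ?thesis using False by (simp add: field_simps)
  qed simp
  \<comment> \<open>By maximality the form of \<open>h\<close> is nonnegative on \<open>S\<close>
    and vanishes at \<open>x\<close>, so \<open>norm_sq_le_selfadjoint\<close> forces
    \<open>h x = 0\<close>; the operator bound \<open>K\<close> supplies its upper bound.\<close>
  define h where "h = (\<lambda>y. l *\<^sub>R y - f y)"
  have h: "linear h" unfolding h_def by (intro linear_compose_sub f linear_scale_self)
  obtain K where K: "\<And>y. norm (h y) \<le> norm y * K"
    using bounded_linear.bounded[OF linear_conv_bounded_linear[THEN iffD1, OF h]] by blast
  have "(norm (h x))\<^sup>2 \<le> K * (x \<bullet> h x)"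
  proof (rule norm_sq_le_selfadjoint[where S = S])
    show "linear h" by (rule h)
    show "h ` S \<subseteq> S" unfolding h_def using S inv
      by (auto intro!: subspace_diff subspace_scale)
    show "h a \<bullet> b = a \<bullet> h b" for a b by (simp add: h_def inner_diff sa)
    show "0 \<le> a \<bullet> h a" if "a \<in> S" for a
      using ray[OF that] by (simp add: h_def inner_diff power2_norm_eq_inner)
    show "a \<bullet> h a \<le> K * (norm a)\<^sup>2" for a
    proof -
      have "a \<bullet> h a \<le> norm a * norm (h a)" by (rule norm_cauchy_schwarz)
      also have "\<dots> \<le> norm a * (norm a * K)" using K by (simp add: mult_left_mono)
      finally show ?thesis by (simp add: power2_eq_square mult_ac)
    qed
  qed (use S x in auto)
  also have "x \<bullet> h x = 0" using x
    by (simp add: h_def inner_diff l_def flip: power2_norm_eq_inner)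
  finally have "f x = l *\<^sub>R x" by (simp add: h_def)
  with x ray show ?thesis by auto
qed

text \<open>Induction on the dimension of the invariant subspace: an extremal eigenvector is split
  off, and self-adjointness keeps its orthogonal complement in \<open>S\<close> invariant.\<close>

lemma orthonormal_eigenbasis:
  fixes f :: "'a::euclidean_space \<Rightarrow> 'a"
  assumes f: "linear f" and sa: "\<And>x y. f x \<bullet> y = x \<bullet> f y"
  shows "subspace S \<Longrightarrow> f ` S \<subseteq> S \<Longrightarrow>
    \<exists>E \<mu>. finite E \<and> span E = S \<and> pairwise orthogonal E \<and> (\<forall>e\<in>E. norm e = 1 \<and> f e = \<mu> e *\<^sub>R e)"
proof (induction "dim S" arbitrary: S rule: less_induct)
  case less
  show ?case
  proof (cases "S = {0}")
    case True
    then show ?thesis by (intro exI[of _ "{}"]) simp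
  next
    case False
    then obtain x l where x: "x \<in> S" "norm x = 1" "f x = l *\<^sub>R x"
      using extremal_eigenvector[OF f less.prems sa] by blast
    define S' where "S' = S \<inter> {y. x \<bullet> y = 0}"
    have xx: "x \<bullet> x = 1" using x by (simp flip: power2_norm_eq_inner)
    have S': "subspace S'" unfolding S'_def
      by (intro subspace_inter less.prems subspace_hyperplane)
    have "f ` S' \<subseteq> S'" using less.prems(2)
      by (auto simp: S'_def x(3) simp flip: sa)
    moreover have "dim S' < dim S"
    proof (rule dim_psubset)
      have "x \<notin> S'" using xx by (simp add: S'_def)
      then have "S' \<subset> S" using x(1) unfolding S'_def by blast
      then show "span S' \<subset> span S" using less.prems(1) S'
        by (simp add: span_eq_iff[THEN iffD2])
    qed
    ultimately obtain E \<mu> where E: "finite E" "span E = S'" "pairwise orthogonal E"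
      "\<forall>e\<in>E. norm e = 1 \<and> f e = \<mu> e *\<^sub>R e"
      using less.hyps S' by blast
    have xE: "x \<bullet> e = 0" if "e \<in> E" for e
      using E(2) span_base[OF that] by (auto simp: S'_def)
    then have "x \<notin> E" using xx by fastforce
    have "span (insert x E) = S"
    proof
      have "insert x E \<subseteq> S" using E(2) x(1) span_superset[of E] by (auto simp: S'_def)
      then show "span (insert x E) \<subseteq> S" using less.prems(1) by (rule span_minimal)
      show "S \<subseteq> span (insert x E)"
      proof
        fix y assume "y \<in> S"
        then have "y - (x \<bullet> y) *\<^sub>R x \<in> S'"
          using x(1) less.prems(1) xx
          by (auto simp: S'_def inner_diff_right intro!: subspace_diff subspace_scale)
        then show "y \<in> span (insert x E)"
          unfolding span_insert using E(2) by blast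
      qed
    qed
    moreover have "pairwise orthogonal (insert x E)"
      using E(3) xE by (auto simp: pairwise_insert orthogonal_def inner_commute)
    moreover have "\<forall>e\<in>insert x E. norm e = 1 \<and> f e = (\<mu>(x := l)) e *\<^sub>R e"
      using E(4) x \<open>x \<notin> E\<close> by auto
    ultimately show ?thesis using E(1) by blast
  qed
qed

lemma symmetric_eigenbasis:
  fixes M :: "real^'n^'n"
  assumes "transpose M = M"
  shows "\<exists>E \<mu>. finite E \<and> span E = UNIV \<and> pairwise orthogonal E \<and>
    (\<forall>e\<in>E. norm e = 1 \<and> M *v e = \<mu> e *\<^sub>R e)"
  using assms by (intro orthonormal_eigenbasis) (auto simp: symmetric_iff)

text \<open>An eigenvector cannot be orthogonal to a whole eigenbasis, and symmetry equates its
  eigenvalue with that of any basis vector it is not orthogonal to. Finiteness gives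
  \<open>Max\<close> and \<open>Min\<close> of the spectrum their meaning.\<close>

lemma finite_eigenvalues:
  fixes M :: "real^'n^'n"
  assumes M: "transpose M = M"
  shows "finite (eigenvalues M)"
proof -
  obtain E \<mu> where E: "finite E" "span E = UNIV" "pairwise orthogonal E"
    "\<And>e. e \<in> E \<Longrightarrow> norm e = 1" "\<And>e. e \<in> E \<Longrightarrow> M *v e = \<mu> e *\<^sub>R e"
    using symmetric_eigenbasis[OF M] by blast
  have "eigenvalues M \<subseteq> \<mu> ` E"
  proof
    fix l assume "l \<in> eigenvalues M"
    then obtain x where x: "x \<noteq> 0" "M *v x = l *\<^sub>R x" by (auto simp: eigenvalues_def)
    obtain e where e: "e \<in> E" "x \<bullet> e \<noteq> 0"
    proof (rule ccontr)
      assume "\<not> thesis"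
      then have "\<And>e. e \<in> E \<Longrightarrow> orthogonal x e" using that by (auto simp: orthogonal_def)
      then have "orthogonal x x" using orthogonal_to_span[of x E x] E(2) by auto
      then show False using x by (simp add: orthogonal_self)
    qed
    have "l * (x \<bullet> e) = \<mu> e * (x \<bullet> e)"
      using M[unfolded symmetric_iff, rule_format, of x e] E(5)[OF e(1)] x(2) by simp
    then show "l \<in> \<mu> ` E" using e by auto
  qed
  then show ?thesis using E(1) finite_surj by blast
qed

text \<open>The maximal Rayleigh quotient \<open>l\<close> is itself an eigenvalue, hence at most
  the largest one, which inherits the quadratic bound.\<close>

lemma max_eigenvalue:
  fixes M :: "real^'n^'n"
  assumes M: "transpose M = M"
  shows "max_eigenvalue M \<in> eigenvalues M"
    and "x \<bullet> (M *v x) \<le> max_eigenvalue M * (norm x)\<^sup>2"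
proof -
  have "\<exists>y\<in>UNIV. \<exists>l. norm y = 1 \<and> M *v y = l *\<^sub>R y \<and>
      (\<forall>x\<in>UNIV. x \<bullet> (M *v x) \<le> l * (norm x)\<^sup>2)"
    using M UNIV_not_singleton by (intro extremal_eigenvector) (auto simp: symmetric_iff)
  then obtain y l where y: "norm y = 1" "M *v y = l *\<^sub>R y"
    "\<And>x. x \<bullet> (M *v x) \<le> l * (norm x)\<^sup>2" by blast
  then have "y \<noteq> 0" by auto
  with y(2) have l: "l \<in> eigenvalues M" by (auto simp: eigenvalues_def)
  then show "max_eigenvalue M \<in> eigenvalues M"
    unfolding max_eigenvalue_def using finite_eigenvalues[OF M] by (intro Max_in) auto
  have "l \<le> max_eigenvalue M"
    unfolding max_eigenvalue_def using finite_eigenvalues[OF M] l by (rule Max_ge)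
  then have "l * (norm x)\<^sup>2 \<le> max_eigenvalue M * (norm x)\<^sup>2"
    by (rule mult_right_mono) simp
  then show "x \<bullet> (M *v x) \<le> max_eigenvalue M * (norm x)\<^sup>2"
    using y(3)[of x] by linarith
qed

text \<open>Follows from the largest eigenvalue of \<open>- M\<close>, since negation reverses the
  spectrum.\<close>

lemma min_eigenvalue:
  fixes M :: "real^'n^'n"
  assumes M: "transpose M = M"
  shows "min_eigenvalue M \<in> eigenvalues M"
    and "min_eigenvalue M * (norm x)\<^sup>2 \<le> x \<bullet> (M *v x)"
proof -
  have neg: "(- M) *v x = - (M *v x)" for x
    using matrix_vector_mult_diff_rdistrib[of 0 M x] by simp
  have nM: "transpose (- M) = - M"
    unfolding symmetric_iff using M by (simp add: neg symmetric_iff)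
  obtain y where y: "y \<noteq> 0" "- (M *v y) = max_eigenvalue (- M) *\<^sub>R y"
    using max_eigenvalue(1)[OF nM] by (auto simp: eigenvalues_def neg)
  have "M *v y = - max_eigenvalue (- M) *\<^sub>R y" using y(2)[symmetric] by simp
  with y(1) have l: "- max_eigenvalue (- M) \<in> eigenvalues M" by (auto simp: eigenvalues_def)
  then show "min_eigenvalue M \<in> eigenvalues M"
    unfolding min_eigenvalue_def using finite_eigenvalues[OF M] by (intro Min_in) auto
  have "min_eigenvalue M \<le> - max_eigenvalue (- M)"
    unfolding min_eigenvalue_def using finite_eigenvalues[OF M] l by (rule Min_le)
  then have "min_eigenvalue M * (norm x)\<^sup>2 \<le> - max_eigenvalue (- M) * (norm x)\<^sup>2"
    by (rule mult_right_mono) simp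
  then show "min_eigenvalue M * (norm x)\<^sup>2 \<le> x \<bullet> (M *v x)"
    using max_eigenvalue(2)[OF nM, of x] by (simp add: neg)
qed

section \<open>Positive semidefinite matrices, singular values and square roots\<close>

lemma eigenvalues_nonneg:
  assumes "pos_semidef M" "l \<in> eigenvalues M"
  shows "0 \<le> l"
proof -
  obtain x where x: "x \<noteq> 0" "M *v x = l *\<^sub>R x" using assms(2) by (auto simp: eigenvalues_def)
  have "0 \<le> x \<bullet> (M *v x)" using assms(1) by (simp add: pos_semidef_def)
  then have "0 \<le> l * (norm x)\<^sup>2" using x(2) by (simp add: power2_norm_eq_inner)
  then show ?thesis using x(1) by (simp add: zero_le_mult_iff)
qed

lemma pos_semidef_gram: "pos_semidef (transpose (B :: real^'m^'p) ** B)"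
proof -
  have "x \<bullet> ((transpose B ** B) *v x) = (B *v x) \<bullet> (B *v x)" for x
    by (simp only: inner_matrix_left matrix_vector_mul_assoc)
  then show ?thesis by (simp add: pos_semidef_def matrix_transpose_mul)
qed

lemma max_singular_value:
  fixes B :: "real^'m^'p"
  shows "0 \<le> max_singular_value B" and "norm (B *v x) \<le> max_singular_value B * norm x"
proof -
  let ?M = "transpose B ** B"
  have sym: "transpose ?M = ?M" using pos_semidef_gram pos_semidef_def by blast
  let ?l = "max_eigenvalue ?M"
  have l: "?l \<in> eigenvalues ?M" using max_eigenvalue(1)[OF sym] .
  then have l0: "0 \<le> ?l" using eigenvalues_nonneg pos_semidef_gram by blast
  have le: "sqrt ?l \<le> max_singular_value B"
    unfolding max_singular_value_def using finite_eigenvalues[OF sym] l by (intro Max_ge) auto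
  then show "0 \<le> max_singular_value B" using real_sqrt_ge_zero[OF l0] by linarith
  have "(norm (B *v x))\<^sup>2 = x \<bullet> (?M *v x)"
    by (simp only: power2_norm_eq_inner inner_matrix_left matrix_vector_mul_assoc)
  also have "\<dots> \<le> (sqrt ?l * norm x)\<^sup>2"
    using max_eigenvalue(2)[OF sym, of x] l0 by (simp add: power_mult_distrib)
  finally have "norm (B *v x) \<le> sqrt ?l * norm x"
    by (rule power2_le_imp_le) (simp add: l0)
  also have "\<dots> \<le> max_singular_value B * norm x" using le by (simp add: mult_right_mono)
  finally show "norm (B *v x) \<le> max_singular_value B * norm x" .
qed

text \<open>Uniqueness half of the square root. The product of \<open>R + sqrt l\<close> and
  \<open>R - sqrt l\<close> annihilates \<open>e\<close>, so a nonzero \<open>d\<close> would be an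
  eigenvector of \<open>R\<close> for the negative value \<open>- sqrt l\<close>. For
  \<open>l = 0\<close>, the squared norm of \<open>R *v e\<close> is the form of
  \<open>R ** R\<close> at \<open>e\<close>, which is zero.\<close>

lemma psd_sqrt_eigenvector:
  fixes R :: "real^'n^'n"
  assumes R: "pos_semidef R" and e: "(R ** R) *v e = l *\<^sub>R e" and l: "0 \<le> l"
  shows "R *v e = sqrt l *\<^sub>R e"
proof (cases "l = 0")
  case True
  have "(R *v e) \<bullet> (R *v e) = e \<bullet> ((R ** R) *v e)"
    using R by (simp add: pos_semidef_def inner_matrix_left matrix_vector_mul_assoc[symmetric])
  then show ?thesis using e True by simp
next
  case False
  define d where "d = R *v e - sqrt l *\<^sub>R e"
  have "R *v d = - sqrt l *\<^sub>R d"
    using e l by (simp add: d_def algebra_simps matrix_vector_mult_scaleR matrix_vector_mul_assoc)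
  then have "0 \<le> d \<bullet> (- sqrt l *\<^sub>R d)" using R by (metis pos_semidef_def)
  then have "sqrt l * (d \<bullet> d) \<le> 0" by simp
  then have "d \<bullet> d \<le> 0" using False l by (simp add: mult_le_0_iff)
  then have "d = 0" using inner_ge_zero[of d] inner_eq_zero_iff[of d] by linarith
  then show ?thesis by (simp add: d_def)
qed

text \<open>Justifies the definite description: taking roots of the eigenvalues on an eigenbasis of
  \<open>M\<close> gives one root, and by \<open>psd_sqrt_eigenvector\<close> every root acts in
  this way on the basis.\<close>

lemma psd_sqrt:
  fixes M :: "real^'n^'n"
  assumes M: "pos_semidef M"
  shows "pos_semidef (psd_sqrt M) \<and> psd_sqrt M ** psd_sqrt M = M"
proof -
  have sym: "transpose M = M" using M by (simp add: pos_semidef_def)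
  obtain E \<mu> where E: "finite E" "span E = UNIV" "pairwise orthogonal E"
    "\<And>e. e \<in> E \<Longrightarrow> norm e = 1" "\<And>e. e \<in> E \<Longrightarrow> M *v e = \<mu> e *\<^sub>R e"
    using symmetric_eigenbasis[OF sym] by blast
  have ext: "P = Q" if "\<And>e. e \<in> E \<Longrightarrow> P *v e = Q *v e" for P Q :: "real^'n^'n"
    unfolding matrix_eq using that E(2) linear_eq_on_span[of "(*v) P" "(*v) Q" E] by simp
  have l0: "0 \<le> \<mu> e" if "e \<in> E" for e
  proof -
    have "e \<noteq> 0" using E(4)[OF that] by auto
    then have "\<mu> e \<in> eigenvalues M" using E(5)[OF that] by (auto simp: eigenvalues_def)
    then show ?thesis using eigenvalues_nonneg M by blast
  qed
  define f where "f = (\<lambda>x. \<Sum>e\<in>E. (sqrt (\<mu> e) * (e \<bullet> x)) *\<^sub>R e)"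
  have "linear f" unfolding f_def
    by (intro linearI) (simp_all add: inner_add_right scaleR_add_left sum.distrib algebra_simps scaleR_right.sum)
  then have f: "matrix f *v x = f x" for x by (simp add: matrix_works)
  have fe: "f e = sqrt (\<mu> e) *\<^sub>R e" if e: "e \<in> E" for e
  proof -
    have "f e = (\<Sum>e'\<in>E. if e' = e then sqrt (\<mu> e) *\<^sub>R e else 0)"
      unfolding f_def
    proof (rule sum.cong)
      fix e' assume e': "e' \<in> E"
      show "(sqrt (\<mu> e') * (e' \<bullet> e)) *\<^sub>R e' = (if e' = e then sqrt (\<mu> e) *\<^sub>R e else 0)"
      proof (cases "e' = e")
        case True
        have "e \<bullet> e = 1" using E(4)[OF e] by (simp flip: power2_norm_eq_inner)
        then show ?thesis using True by simp
      next
        case False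
        then have "e' \<bullet> e = 0" using E(3) e e' by (auto simp: pairwise_def orthogonal_def)
        then show ?thesis using False by simp
      qed
    qed simp
    then show ?thesis using E(1) e by simp
  qed
  have "pos_semidef (matrix f)"
    unfolding pos_semidef_def symmetric_iff f
  proof (intro conjI allI)
    show "f x \<bullet> y = x \<bullet> f y" for x y
      by (simp add: f_def inner_sum_left inner_sum_right algebra_simps inner_commute)
    show "0 \<le> x \<bullet> f x" for x
      unfolding f_def inner_sum_right
    proof (rule sum_nonneg)
      fix e assume "e \<in> E"
      then have "0 \<le> sqrt (\<mu> e) * (e \<bullet> x)\<^sup>2" using l0 by simp
      then show "0 \<le> x \<bullet> ((sqrt (\<mu> e) * (e \<bullet> x)) *\<^sub>R e)"
        by (simp add: power2_eq_square inner_commute mult.assoc)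
    qed
  qed
  moreover have "matrix f ** matrix f = M"
    by (rule ext)
      (simp add: matrix_vector_mul_assoc[symmetric] f fe linear_scale[OF \<open>linear f\<close>] l0 E(5))
  moreover have "R = matrix f" if "pos_semidef R \<and> R ** R = M" for R
    using that by (intro ext) (simp add: f fe psd_sqrt_eigenvector E(5) l0)
  ultimately have "\<exists>!R. pos_semidef R \<and> R ** R = M" by blast
  then show ?thesis unfolding psd_sqrt_def by (rule theI')
qed

text \<open>With \<open>R\<close> the root of \<open>A ** transpose A\<close>, the norms of
  \<open>R *v a\<close> and \<open>transpose A *v a\<close> agree, and Cauchy-Schwarz turns the
  lower bound on the form of \<open>R\<close> into one on \<open>norm (R *v a)\<close>.\<close>

lemma sigma_min_le:
  fixes A :: "real^'n^'p"
  shows "(sigma_min A)\<^sup>2 * (norm a)\<^sup>2 \<le> (norm (transpose A *v a))\<^sup>2"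
proof -
  let ?R = "psd_sqrt (A ** transpose A)"
  have "pos_semidef (A ** transpose A)"
    using pos_semidef_gram[of "transpose A"] by simp
  then have R: "pos_semidef ?R" "?R ** ?R = A ** transpose A" using psd_sqrt by blast+
  then have sym: "transpose ?R = ?R" by (simp add: pos_semidef_def)
  have "0 \<le> sigma_min A"
    unfolding sigma_min_def using eigenvalues_nonneg[OF R(1)] min_eigenvalue(1)[OF sym] .
  have "sigma_min A * (norm a)\<^sup>2 \<le> a \<bullet> (?R *v a)"
    unfolding sigma_min_def by (rule min_eigenvalue(2)[OF sym])
  also have "\<dots> \<le> norm a * norm (?R *v a)" by (rule norm_cauchy_schwarz)
  finally have "sigma_min A * norm a \<le> norm (?R *v a)"
    by (cases "a = 0") (simp_all add: power2_eq_square)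
  then have "(sigma_min A * norm a)\<^sup>2 \<le> (norm (?R *v a))\<^sup>2"
    using \<open>0 \<le> sigma_min A\<close> by (simp add: power_mono)
  also have "\<dots> = a \<bullet> ((?R ** ?R) *v a)"
    by (simp add: power2_norm_eq_inner inner_matrix_left sym matrix_vector_mul_assoc)
  also have "\<dots> = (norm (transpose A *v a))\<^sup>2"
    by (simp only: R(2) power2_norm_eq_inner inner_matrix_left matrix_vector_mul_assoc
        transpose_transpose)
  finally show ?thesis by (simp add: power_mult_distrib)
qed

section \<open>Convex functions\<close>

lemma gderiv_eq_subgradient:
  assumes d: "GDERIV f x :> d" and p: "\<And>y. f x + p \<bullet> (y - x) \<le> f y"
  shows "d = p"
proof -
  have "((\<lambda>y. f y - p \<bullet> y) has_derivative (\<lambda>h. h \<bullet> d - p \<bullet> h)) (at x)"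
    using d unfolding gderiv_def by (intro derivative_intros)
  moreover have "\<forall>y\<in>UNIV. f x - p \<bullet> x \<le> f y - p \<bullet> y"
    using p by (simp add: inner_diff_right algebra_simps)
  ultimately have "(\<lambda>h. h \<bullet> d - p \<bullet> h) = (\<lambda>h. 0)"
    by (intro differential_zero_maxmin[where S = UNIV]) auto
  then have "(d - p) \<bullet> d - p \<bullet> (d - p) = 0" by (rule fun_cong)
  then have "(d - p) \<bullet> (d - p) = 0" by (simp add: algebra_simps inner_commute)
  then show ?thesis by simp
qed

text \<open>Restriction to the line through \<open>x\<close> and \<open>y\<close> reduces this to
  the tangent inequality in one real variable.\<close>

lemma convex_above_gradient:
  fixes f :: "'a::real_inner \<Rightarrow> real"
  assumes f: "convex_on UNIV f" and d: "GDERIV f x :> d"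
  shows "f x + d \<bullet> (y - x) \<le> f y"
proof -
  define h where "h = (\<lambda>t. f (x + t *\<^sub>R (y - x)))"
  have "convex_on UNIV h"
  proof (rule convex_onI)
    fix t a b :: real assume "0 < t" "t < 1"
    have "h ((1 - t) *\<^sub>R a + t *\<^sub>R b) =
        f ((1 - t) *\<^sub>R (x + a *\<^sub>R (y - x)) + t *\<^sub>R (x + b *\<^sub>R (y - x)))"
      unfolding h_def by (rule arg_cong[where f = f]) (simp add: algebra_simps)
    also have "\<dots> \<le> (1 - t) * h a + t * h b"
      unfolding h_def using \<open>0 < t\<close> \<open>t < 1\<close> by (intro convex_onD[OF f]) auto
    finally show "h ((1 - t) *\<^sub>R a + t *\<^sub>R b) \<le> (1 - t) * h a + t * h b" .
  qed simp
  moreover have "(h has_real_derivative d \<bullet> (y - x)) (at 0)"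
  proof -
    have f': "(f has_derivative (\<lambda>h. h \<bullet> d)) (at (x + 0 *\<^sub>R (y - x)))"
      using d by (simp add: gderiv_def)
    have "((\<lambda>t. x + t *\<^sub>R (y - x)) has_derivative (\<lambda>t. t *\<^sub>R (y - x))) (at 0)"
      by (auto intro!: derivative_eq_intros)
    from has_derivative_compose[OF this f'] show ?thesis
      by (simp add: h_def has_field_derivative_def inner_commute mult.commute[of _ "d \<bullet> (y - x)"])
  qed
  ultimately have "h 1 - h 0 \<ge> (d \<bullet> (y - x)) * (1 - 0)"
    by (intro convex_on_imp_above_tangent[of UNIV]) auto
  then show ?thesis by (simp add: h_def)
qed

text \<open>Cocoercivity: compare the tangent at \<open>x\<close> with the quadratic upper bound at \<open>y\<close>, both
  evaluated at the gradient step \<open>y - \<gamma> (q - p)\<close>.\<close>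

lemma smooth_convex_lower_bound:
  fixes f :: "'a::real_inner \<Rightarrow> real"
  assumes \<gamma>: "0 < \<gamma>" and f: "convex_on UNIV f" and smooth: "smooth_fun (1 / \<gamma>) f"
    and p: "GDERIV f x :> p" and q: "GDERIV f y :> q"
  shows "f x + p \<bullet> (y - x) + \<gamma> / 2 * (norm (p - q))\<^sup>2 \<le> f y"
proof -
  define z where "z = y - \<gamma> *\<^sub>R (q - p)"
  have "f x + p \<bullet> (z - x) \<le> f z" by (rule convex_above_gradient[OF f p])
  moreover have "f z - f y - q \<bullet> (z - y) \<le> 1 / \<gamma> / 2 * (norm (y - z))\<^sup>2"
    using smooth q unfolding smooth_fun_def bregman_def
    by (metis ereal_less_eq(3) ereal_minus(1))
  moreover have "1 / \<gamma> / 2 * (norm (y - z))\<^sup>2 = \<gamma> / 2 * (norm (p - q))\<^sup>2"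
    using \<gamma> by (simp add: z_def power_mult_distrib norm_minus_commute) (simp add: power2_eq_square)
  moreover have "p \<bullet> (z - x) = p \<bullet> (y - x) - \<gamma> * (p \<bullet> (q - p))"
    "q \<bullet> (z - y) = - \<gamma> * (q \<bullet> (q - p))"
    by (simp_all add: z_def algebra_simps)
  \<comment> \<open>The two inner product corrections add up to this; the quadratic upper bound
    consumes half of it.\<close>
  moreover have "\<gamma> * (norm (p - q))\<^sup>2 = \<gamma> * (q \<bullet> (q - p)) - \<gamma> * (p \<bullet> (q - p))"
    by (simp add: power2_norm_eq_inner algebra_simps inner_commute)
  ultimately show ?thesis by linarith
qed

text \<open>The subgradient inequality says that the supremum defining the conjugate is attained at
  \<open>x\<close>: the equality case of Fenchel-Young.\<close>

lemma conjugate_at_subgradient: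
  assumes "\<And>y. f x + p \<bullet> (y - x) \<le> f y"
  shows "conjugate (\<lambda>u. ereal (f u)) p = ereal (p \<bullet> x - f x)"
  unfolding conjugate_def
proof (rule antisym)
  show "(SUP u. ereal (p \<bullet> u) - ereal (f u)) \<le> ereal (p \<bullet> x - f x)"
    using assms by (intro SUP_least) (simp add: inner_diff_right algebra_simps)
  show "ereal (p \<bullet> x - f x) \<le> (SUP u. ereal (p \<bullet> u) - ereal (f u))"
    by (rule SUP_upper2[of x]) auto
qed

text \<open>Testing the subgradient inequality of the conjugate at \<open>d\<close> gives equality in
  Fenchel--Young at \<open>(x, p)\<close>.\<close>

lemma gderiv_if_conjugate_subgradient:
  fixes f :: "'a::real_inner \<Rightarrow> real"
  assumes f: "convex_on UNIV f" and d: "GDERIV f x :> d"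
    and x: "x \<in> subdifferential (conjugate (\<lambda>u. ereal (f u))) p"
  shows "d = p"
proof (rule gderiv_eq_subgradient[OF d])
  fix y
  let ?c = "conjugate (\<lambda>u. ereal (f u))"
  have "?c d = ereal (d \<bullet> x - f x)"
    by (rule conjugate_at_subgradient) (rule convex_above_gradient[OF f d])
  then have "?c p + ereal (x \<bullet> (d - p)) \<le> ereal (d \<bullet> x - f x)"
    using x unfolding subdifferential_def by (metis (no_types, lifting) mem_Collect_eq)
  then have "?c p \<le> ereal (p \<bullet> x - f x)"
    by (cases "?c p") (auto simp: inner_diff_right inner_commute)
  moreover have "ereal (p \<bullet> y) - ereal (f y) \<le> ?c p"
    unfolding conjugate_def by (rule SUP_upper) simp
  ultimately have "ereal (p \<bullet> y) - ereal (f y) \<le> ereal (p \<bullet> x - f x)" by (rule order_trans[rotated])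
  then show "f x + p \<bullet> (y - x) \<le> f y" by (simp add: inner_diff_right)
qed

lemma convex_ereal_real:
  assumes "convex_on UNIV f"
  shows "convex_ereal (\<lambda>x. ereal (f x))"
proof -
  have "{(x, r). ereal (f x) \<le> ereal r} = epigraph UNIV f" by (auto simp: epigraph_def)
  then show ?thesis using assms by (simp add: convex_ereal_def convex_epigraph)
qed

section \<open>First-order optimality of proximal updates\<close>

lemma nonneg_if_perturbation_nonneg:
  fixes X C :: real
  assumes "\<And>\<tau>. 0 < \<tau> \<Longrightarrow> \<tau> < 1 \<Longrightarrow> 0 \<le> X + \<tau> * C"
  shows "0 \<le> X"
proof (rule tendsto_lowerbound)
  show "((\<lambda>\<tau>. X + \<tau> * C) \<longlongrightarrow> X) (at_right 0)"
    by (auto intro!: tendsto_eq_intros)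
  show "\<forall>\<^sub>F \<tau> in at_right 0. 0 \<le> X + \<tau> * C"
    unfolding eventually_at_right_field using assms by (intro exI[of _ 1]) auto
qed simp

text \<open>One statement for both updates, with \<phi> embedded in \<open>ereal\<close>. Along the
  segment from \<open>x\<close> to \<open>y\<close> convexity makes the growth of \<open>h\<close>
  at most linear in \<tau>, while the smooth part is expanded exactly; dividing by \<tau> and
  letting it tend to zero leaves the subgradient inequality.\<close>

lemma prox_minimizer_subgradient:
  fixes h :: "real^'n \<Rightarrow> ereal" and K :: "real^'n^'p" and M :: "real^'n^'n"
  assumes h: "proper_fun h" "convex_ereal h" and M: "pos_semidef M"
    and x: "is_arg_min
      (\<lambda>u. h u + ereal (l \<bullet> (K *v u) + \<rho> / 2 * (norm (K *v u - k))\<^sup>2 + \<mu> / 2 * norm_sq_wrt M (u - z)))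
      (\<lambda>_. True) x"
  shows "- (transpose K *v (l + \<rho> *\<^sub>R (K *v x - k)) + \<mu> *\<^sub>R (M *v (x - z))) \<in> subdifferential h x"
proof -
  define q where "q = (\<lambda>u. l \<bullet> (K *v u) + \<rho> / 2 * (norm (K *v u - k))\<^sup>2 + \<mu> / 2 * norm_sq_wrt M (u - z))"
  define d where "d = transpose K *v (l + \<rho> *\<^sub>R (K *v x - k)) + \<mu> *\<^sub>R (M *v (x - z))"
  have sym: "(M *v a) \<bullet> b = a \<bullet> (M *v b)" for a b
    using M by (simp add: pos_semidef_def symmetric_iff)
  \<comment> \<open>\<open>q\<close> is quadratic, so this expansion is exact, with \<open>d\<close>
    the gradient at \<open>x\<close>.\<close>
  have q: "q (x + \<tau> *\<^sub>R u) = q x + \<tau> * (d \<bullet> u)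
      + \<tau>\<^sup>2 * (\<rho> / 2 * (norm (K *v u))\<^sup>2 + \<mu> / 2 * norm_sq_wrt M u)" for \<tau> u
  proof -
    have 1: "K *v (x + \<tau> *\<^sub>R u) = K *v x + \<tau> *\<^sub>R (K *v u)"
      by (simp add: matrix_vector_right_distrib matrix_vector_mult_scaleR)
    have 2: "(norm (K *v x + \<tau> *\<^sub>R (K *v u) - k))\<^sup>2 =
        (norm (K *v x - k))\<^sup>2 + 2 * \<tau> * ((K *v x - k) \<bullet> (K *v u)) + \<tau>\<^sup>2 * (norm (K *v u))\<^sup>2"
      by (simp add: power2_norm_eq_inner algebra_simps inner_commute power2_eq_square[of \<tau>])
    have 3: "norm_sq_wrt M (x + \<tau> *\<^sub>R u - z) =
        norm_sq_wrt M (x - z) + 2 * \<tau> * ((M *v (x - z)) \<bullet> u) + \<tau>\<^sup>2 * norm_sq_wrt M u"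
    proof -
      define e where "e = x - z"
      have A: "(e + \<tau> *\<^sub>R u) \<bullet> (M *v (e + \<tau> *\<^sub>R u)) =
          e \<bullet> (M *v e) + \<tau> * (e \<bullet> (M *v u)) + \<tau> * (u \<bullet> (M *v e)) + \<tau>\<^sup>2 * (u \<bullet> (M *v u))"
        by (simp only: matrix_vector_right_distrib matrix_vector_mult_scaleR inner_add_left
            inner_add_right inner_scaleR_left inner_scaleR_right power2_eq_square) algebra
      have B: "e \<bullet> (M *v u) = (M *v e) \<bullet> u" "u \<bullet> (M *v e) = (M *v e) \<bullet> u"
        by (simp_all only: sym inner_commute[of u])
      have eq: "x + \<tau> *\<^sub>R u - z = e + \<tau> *\<^sub>R u" by (simp add: e_def)
      show ?thesis unfolding norm_sq_wrt_def eq e_def[symmetric] A B by simp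
    qed
    have 4: "d \<bullet> u = l \<bullet> (K *v u) + \<rho> * ((K *v x - k) \<bullet> (K *v u)) + \<mu> * ((M *v (x - z)) \<bullet> u)"
      using inner_matrix_left[of "transpose K" "l + \<rho> *\<^sub>R (K *v x - k)" u]
      unfolding d_def by (simp only: inner_add_left inner_scaleR_left transpose_transpose)
    show ?thesis unfolding q_def 1 2 3 4 by (simp add: inner_add_right field_simps)
  qed
  have min: "h x + ereal (q x) \<le> h y + ereal (q y)" for y
    using x unfolding is_arg_min_def q_def by (auto simp: not_less)
  have hm: "h y \<noteq> - \<infinity>" for y using h(1) by (simp add: proper_fun_def)
  \<comment> \<open>Comparison with a point of finite value makes \<open>h x\<close> finite, as
    membership in the subdifferential demands.\<close>
  obtain y0 where "h y0 \<noteq> \<infinity>" using h(1) by (auto simp: proper_fun_def)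
  then have "h x \<noteq> \<infinity>" using min[of y0] by auto
  then obtain a where a: "h x = ereal a" using hm[of x] by (cases "h x") auto
  have "h x + ereal (- d \<bullet> (y - x)) \<le> h y" for y
  proof (cases "h y")
    case (real b)
    let ?C = "\<rho> / 2 * (norm (K *v (y - x)))\<^sup>2 + \<mu> / 2 * norm_sq_wrt M (y - x)"
    have "0 \<le> b - a + d \<bullet> (y - x)"
    proof (rule nonneg_if_perturbation_nonneg)
      fix \<tau> :: real assume \<tau>: "0 < \<tau>" "\<tau> < 1"
      let ?z = "x + \<tau> *\<^sub>R (y - x)"
      have "(1 - \<tau>) *\<^sub>R (x, a) + \<tau> *\<^sub>R (y, b) \<in> {(x, r). h x \<le> ereal r}"
        using h(2) \<tau> a real unfolding convex_ereal_def by (intro convexD_alt) auto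
      then have "h ?z \<le> ereal ((1 - \<tau>) * a + \<tau> * b)"
        by (simp add: algebra_simps)
      then have "h ?z + ereal (q ?z) \<le> ereal ((1 - \<tau>) * a + \<tau> * b) + ereal (q ?z)"
        by (rule add_right_mono)
      with min[of ?z] have "h x + ereal (q x) \<le> ereal ((1 - \<tau>) * a + \<tau> * b) + ereal (q ?z)"
        by (rule order_trans)
      then have "a + q x \<le> (1 - \<tau>) * a + \<tau> * b + q ?z" by (simp add: a)
      then have "0 \<le> \<tau> * (b - a + d \<bullet> (y - x) + \<tau> * ?C)"
        unfolding q by (simp add: algebra_simps power2_eq_square)
      then show "0 \<le> b - a + d \<bullet> (y - x) + \<tau> * ?C"
        using \<tau>(1) by (simp only: zero_le_mult_iff) linarith
    qed
    then show ?thesis by (simp add: a real)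
  qed (use hm in auto)
  then show ?thesis unfolding d_def[symmetric] subdifferential_def by (simp add: a)
qed

section \<open>One step of the algorithm\<close>

lemma two_mul_le_add:
  fixes z a b :: real
  assumes "z\<^sup>2 \<le> a * b" "0 \<le> a" "0 \<le> b"
  shows "2 * z \<le> a + b"
proof (rule power2_le_imp_le)
  have "(2 * z)\<^sup>2 \<le> 4 * (a * b)" using assms(1) by (simp add: power_mult_distrib)
  also have "\<dots> \<le> (a + b)\<^sup>2" using zero_le_power2[of "a - b"] by (simp add: power2_eq_square algebra_simps)
  finally show "(2 * z)\<^sup>2 \<le> (a + b)\<^sup>2" .
qed (use assms in simp)

text \<open>Weighted Cauchy-Schwarz; the defect is a perfect square divided by
  \<open>a * b\<close>.\<close>

lemma sum_sq_le_weighted: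
  fixes Y Z a b :: real
  assumes "0 < a" "0 < b"
  shows "(Z + Y)\<^sup>2 \<le> (a + b) * (Z\<^sup>2 / a + Y\<^sup>2 / b)"
proof -
  have "(a + b) * (Z\<^sup>2 / a + Y\<^sup>2 / b) - (Z + Y)\<^sup>2 = (b * Z - a * Y)\<^sup>2 / (a * b)"
    using assms by (simp add: power2_eq_square field_simps)
  also have "\<dots> \<ge> 0" using assms by simp
  finally show ?thesis by simp
qed

text \<open>The dual error is controlled by the cocoercivity term together with the decrease in the
  proximal term of the \<open>w\<close>-update.\<close>

lemma dual_error_bound:
  fixes A :: "real^'n^'p"
  assumes pos: "0 < \<gamma>" "0 < \<rho>" and H: "pos_semidef H"
    and le: "\<theta> * (\<gamma> * max_eigenvalue H + 1) \<le> \<gamma> * \<rho> * (sigma_min A)\<^sup>2"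
  shows "\<theta> / \<rho> * (norm a)\<^sup>2 \<le> \<gamma> * (norm (transpose A *v a + H *v u))\<^sup>2 + u \<bullet> (H *v u)"
proof -
  define \<sigma> where "\<sigma> = max_eigenvalue H"
  define P where "P = norm (transpose A *v a + H *v u)"
  define Q where "Q = norm (H *v u)"
  define q where "q = u \<bullet> (H *v u)"
  have sym: "transpose H = H" and q: "0 \<le> q" using H by (auto simp: pos_semidef_def q_def)
  have \<sigma>: "0 \<le> \<sigma>"
    unfolding \<sigma>_def using eigenvalues_nonneg[OF H max_eigenvalue(1)[OF sym]] .
  have "Q\<^sup>2 \<le> \<sigma> * q"
    unfolding Q_def q_def \<sigma>_def
    using H max_eigenvalue(2)[OF sym]
    by (intro norm_sq_le_selfadjoint[where S = UNIV]) (auto simp: pos_semidef_def symmetric_iff)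
  \<comment> \<open>Prepares the AM-GM inequality for the cross term of
    \<open>\<gamma> * (P + Q)\<^sup>2\<close>. The resulting terms \<open>q\<close> and
    \<open>\<gamma>\<^sup>2 * \<sigma> * P\<^sup>2\<close> are two of the four products in
    \<open>(\<gamma> * \<sigma> + 1) * (\<gamma> * P\<^sup>2 + q)\<close>.\<close>
  then have "(\<gamma> * (P * Q))\<^sup>2 \<le> q * (\<gamma>\<^sup>2 * \<sigma> * P\<^sup>2)"
    using mult_left_mono[of "Q\<^sup>2" "\<sigma> * q" "\<gamma>\<^sup>2 * P\<^sup>2"] by (simp add: power_mult_distrib mult_ac)
  then have "2 * (\<gamma> * (P * Q)) \<le> q + \<gamma>\<^sup>2 * \<sigma> * P\<^sup>2"
    using q \<sigma> by (intro two_mul_le_add) auto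
  moreover have "\<gamma> * Q\<^sup>2 \<le> \<gamma> * (\<sigma> * q)" using \<open>Q\<^sup>2 \<le> \<sigma> * q\<close> pos by simp
  ultimately have "\<gamma> * (P + Q)\<^sup>2 \<le> (\<gamma> * \<sigma> + 1) * (\<gamma> * P\<^sup>2 + q)"
    by (simp add: power2_eq_square algebra_simps)
  moreover have "norm (transpose A *v a) \<le> P + Q"
    using norm_triangle_ineq4[of "transpose A *v a + H *v u" "H *v u"] by (simp add: P_def Q_def)
  then have "(sigma_min A)\<^sup>2 * (norm a)\<^sup>2 \<le> (P + Q)\<^sup>2"
    using sigma_min_le[of A a] power_mono[of "norm (transpose A *v a)" "P + Q" 2] by simp
  then have "\<gamma> * ((sigma_min A)\<^sup>2 * (norm a)\<^sup>2) \<le> \<gamma> * (P + Q)\<^sup>2" using pos by simp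
  moreover have "\<theta> * (\<gamma> * \<sigma> + 1) * (norm a)\<^sup>2 \<le> \<gamma> * \<rho> * (sigma_min A)\<^sup>2 * (norm a)\<^sup>2"
    using le unfolding \<sigma>_def by (rule mult_right_mono) simp
  then have "(\<gamma> * \<sigma> + 1) * (\<theta> / \<rho> * (norm a)\<^sup>2) \<le> \<gamma> * ((sigma_min A)\<^sup>2 * (norm a)\<^sup>2)"
    using pos by (simp add: field_simps)
  ultimately have "(\<gamma> * \<sigma> + 1) * (\<theta> / \<rho> * (norm a)\<^sup>2) \<le> (\<gamma> * \<sigma> + 1) * (\<gamma> * P\<^sup>2 + q)"
    by linarith
  moreover have "0 < \<gamma> * \<sigma> + 1" using pos \<sigma> by (simp add: add_nonneg_pos)
  ultimately show ?thesis unfolding P_def q_def by (simp only: mult_le_cancel_left_pos)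
qed

text \<open>The vector \<open>x\<close> is split as \<open>x - B *v e\<close> plus
  \<open>B *v e\<close>. The condition \<open>le1\<close> lets the first square on the right pay for
  the first part; \<open>le2\<close> lets \<open>\<mu> * (norm e)\<^sup>2\<close> pay for the second
  part and for the \<open>G\<close> term.\<close>

lemma primal_error_bound:
  fixes B :: "real^'m^'p"
  assumes pos: "0 < \<rho>" "0 < \<theta>" "0 \<le> s" "s < 1" and G: "pos_semidef G" and Ht: "pos_semidef Ht"
    and le1: "\<theta> * max_eigenvalue Ht \<le> s * \<rho>"
    and le2: "\<theta> * ((\<rho> + max_eigenvalue Ht) * (max_singular_value B)\<^sup>2
        + (1 - s) * \<rho> * max_singular_value G) \<le> (1 - s) * \<mu>"
  shows "\<theta> / (1 + \<theta>) * (\<rho> * (norm x)\<^sup>2 + norm_sq_wrt Ht x) + \<theta> * \<rho> * norm_sq_wrt G e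
    \<le> \<rho> * (norm (x - B *v e))\<^sup>2 + \<mu> * (norm e)\<^sup>2"
proof -
  define \<sigma> where "\<sigma> = max_eigenvalue Ht"
  define \<tau> where "\<tau> = \<theta> * (\<rho> + \<sigma>)"
  define Y where "Y = norm (B *v e)"
  define Z where "Z = norm (x - B *v e)"
  have sym: "transpose Ht = Ht" using Ht by (simp add: pos_semidef_def)
  have \<sigma>: "0 \<le> \<sigma>"
    unfolding \<sigma>_def using eigenvalues_nonneg[OF Ht max_eigenvalue(1)[OF sym]] .
  have \<tau>: "0 < \<tau>" using pos \<sigma> by (simp add: \<tau>_def)
  have "norm x \<le> Z + Y"
    using norm_triangle_ineq[of "x - B *v e" "B *v e"] by (simp add: Z_def Y_def)
  then have "(norm x)\<^sup>2 \<le> (Z + Y)\<^sup>2" by (simp add: power_mono)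
  \<comment> \<open>The weights \<open>\<theta> + s\<close> and \<open>1 - s\<close> sum to
    \<open>1 + \<theta>\<close> and thus cancel the denominator in the claim.\<close>
  also have "\<dots> \<le> ((\<theta> + s) + (1 - s)) * (Z\<^sup>2 / (\<theta> + s) + Y\<^sup>2 / (1 - s))"
    using pos by (intro sum_sq_le_weighted) auto
  finally have "\<tau> * (norm x)\<^sup>2 \<le> \<tau> * ((1 + \<theta>) * (Z\<^sup>2 / (\<theta> + s) + Y\<^sup>2 / (1 - s)))"
    using \<tau> by (intro mult_left_mono) (auto simp: add_ac)
  then have "\<tau> / (1 + \<theta>) * (norm x)\<^sup>2 \<le> \<tau> / (\<theta> + s) * Z\<^sup>2 + \<tau> / (1 - s) * Y\<^sup>2"
    using pos by (simp add: pos_divide_le_eq) (simp add: algebra_simps)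
  \<comment> \<open>As \<open>\<tau> = \<theta> * \<rho> + \<theta> * \<sigma>\<close>, this is
    \<open>le1\<close> after division.\<close>
  moreover have "\<tau> / (\<theta> + s) \<le> \<rho>"
    using le1 pos by (simp add: \<tau>_def \<sigma>_def pos_divide_le_eq algebra_simps)
  then have "\<tau> / (\<theta> + s) * Z\<^sup>2 \<le> \<rho> * Z\<^sup>2" by (rule mult_right_mono) simp
  moreover have "Y\<^sup>2 \<le> (max_singular_value B)\<^sup>2 * (norm e)\<^sup>2"
    using power_mono[OF max_singular_value(2)[of B e], of 2] by (simp add: Y_def power_mult_distrib)
  then have "\<tau> / (1 - s) * Y\<^sup>2 \<le> \<tau> / (1 - s) * ((max_singular_value B)\<^sup>2 * (norm e)\<^sup>2)"
    using \<tau> pos by (intro mult_left_mono) auto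
  moreover have "norm_sq_wrt G e \<le> max_singular_value G * (norm e)\<^sup>2"
  proof -
    have "norm_sq_wrt G e \<le> norm e * norm (G *v e)"
      unfolding norm_sq_wrt_def by (rule norm_cauchy_schwarz)
    also have "\<dots> \<le> norm e * (max_singular_value G * norm e)"
      by (intro mult_left_mono max_singular_value) simp
    finally show ?thesis by (simp add: power2_eq_square mult_ac)
  qed
  then have "\<theta> * \<rho> * norm_sq_wrt G e \<le> \<theta> * \<rho> * (max_singular_value G * (norm e)\<^sup>2)"
    using pos by (intro mult_left_mono) auto
  moreover have "\<tau> / (1 - s) * ((max_singular_value B)\<^sup>2 * (norm e)\<^sup>2)
      + \<theta> * \<rho> * (max_singular_value G * (norm e)\<^sup>2) \<le> \<mu> * (norm e)\<^sup>2"
  proof -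
    have "\<tau> / (1 - s) * (max_singular_value B)\<^sup>2 + \<theta> * \<rho> * max_singular_value G
        = \<theta> * ((\<rho> + \<sigma>) * (max_singular_value B)\<^sup>2 + (1 - s) * \<rho> * max_singular_value G) / (1 - s)"
      using pos by (simp add: \<tau>_def field_simps)
    also have "\<dots> \<le> \<mu>"
      using le2 pos by (simp add: \<sigma>_def pos_divide_le_eq mult.commute[of \<mu>])
    finally have "(\<tau> / (1 - s) * (max_singular_value B)\<^sup>2 + \<theta> * \<rho> * max_singular_value G)
        * (norm e)\<^sup>2 \<le> \<mu> * (norm e)\<^sup>2" by (rule mult_right_mono) simp
    then show ?thesis by (simp add: algebra_simps)
  qed
  \<comment> \<open>Bounding the \<open>Ht\<close> term by \<sigma> times the squared norm makes
    \<tau> the total coefficient of \<open>(norm x)\<^sup>2\<close>, up to the division by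
    \<open>1 + \<theta>\<close>.\<close>
  moreover have "norm_sq_wrt Ht x \<le> \<sigma> * (norm x)\<^sup>2"
    unfolding norm_sq_wrt_def \<sigma>_def by (rule max_eigenvalue(2)[OF sym])
  then have "\<theta> / (1 + \<theta>) * (\<rho> * (norm x)\<^sup>2 + norm_sq_wrt Ht x)
      \<le> \<theta> / (1 + \<theta>) * (\<rho> * (norm x)\<^sup>2 + \<sigma> * (norm x)\<^sup>2)"
    using pos by (intro mult_left_mono) auto
  then have "\<theta> / (1 + \<theta>) * (\<rho> * (norm x)\<^sup>2 + norm_sq_wrt Ht x) \<le> \<tau> / (1 + \<theta>) * (norm x)\<^sup>2"
    using pos by (simp add: \<tau>_def field_simps)
  ultimately show ?thesis unfolding Z_def by linarith
qed

section \<open>Decrease of the potential in one iteration\<close>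

lemma two_inner_diff_psd:
  fixes M :: "real^'n^'n"
  assumes "pos_semidef M"
  shows "2 * (x \<bullet> (M *v (x - y))) = norm_sq_wrt M x - norm_sq_wrt M y + norm_sq_wrt M (x - y)"
proof -
  have "y \<bullet> (M *v x) = x \<bullet> (M *v y)"
    using assms by (metis inner_commute pos_semidef_def symmetric_iff)
  then show ?thesis
    by (simp add: norm_sq_wrt_def matrix_vector_mult_diff_distrib inner_diff_left inner_diff_right)
qed

text \<open>Every inner product is polarized. The square of \<open>x - y\<close> produced by the
  dual update cancels the one from polarizing \<open>(x - x') \<bullet> y\<close>, leaving the
  potential difference and three subtracted squares.\<close>

lemma step_identity:
  fixes x x' y a a' :: "real^'p" and e e' :: "real^'m"
  assumes \<rho>: "0 < \<rho>" and G: "pos_semidef G" and Ht: "pos_semidef Ht"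
    and a: "a - a' = \<rho> *\<^sub>R (x - y)"
  shows "- (a \<bullet> (x - y)) - x \<bullet> (Ht *v (x - x')) - \<rho> * ((x - x') \<bullet> y) - \<rho> * (e \<bullet> (G *v (e - e')))
    = (\<rho> / 2 * (norm x')\<^sup>2 + norm_sq_wrt Ht x' / 2 + \<rho> / 2 * norm_sq_wrt G e' + (norm a')\<^sup>2 / (2 * \<rho>))
      - (\<rho> / 2 * (norm x)\<^sup>2 + norm_sq_wrt Ht x / 2 + \<rho> / 2 * norm_sq_wrt G e + (norm a)\<^sup>2 / (2 * \<rho>))
      - \<rho> / 2 * (norm (x' - y))\<^sup>2 - norm_sq_wrt Ht (x - x') / 2 - \<rho> / 2 * norm_sq_wrt G (e - e')"
proof -
  have a': "a' = a - \<rho> *\<^sub>R (x - y)" using a by (simp add: algebra_simps)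
  have "(norm a')\<^sup>2 / (2 * \<rho>) = (norm a)\<^sup>2 / (2 * \<rho>) - a \<bullet> (x - y) + \<rho> / 2 * (norm (x - y))\<^sup>2"
  proof -
    have "(norm (a - \<rho> *\<^sub>R z))\<^sup>2 = (norm a)\<^sup>2 - 2 * \<rho> * (a \<bullet> z) + \<rho>\<^sup>2 * (norm z)\<^sup>2" for z
      by (simp add: power2_norm_eq_inner inner_diff inner_commute algebra_simps power2_eq_square[of \<rho>])
    then have "(norm a')\<^sup>2 = (norm a)\<^sup>2 - 2 * \<rho> * (a \<bullet> (x - y)) + \<rho>\<^sup>2 * (norm (x - y))\<^sup>2"
      unfolding a' .
    then show ?thesis using \<rho> by (simp add: field_simps power2_eq_square[of \<rho>])
  qed
  moreover have "\<rho> * ((x - x') \<bullet> y) = \<rho> / 2 * (norm (x - y))\<^sup>2 * -1 + \<rho> / 2 * (norm x)\<^sup>2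
      - \<rho> / 2 * (norm x')\<^sup>2 + \<rho> / 2 * (norm (x' - y))\<^sup>2"
    unfolding power2_norm_eq_inner
    by (simp add: inner_diff_left inner_diff_right inner_commute field_simps)
  moreover have "\<rho> * (e \<bullet> (G *v (e - e')))
      = \<rho> / 2 * norm_sq_wrt G e - \<rho> / 2 * norm_sq_wrt G e' + \<rho> / 2 * norm_sq_wrt G (e - e')"
    using arg_cong[OF two_inner_diff_psd[OF G, of e e'], of "(*) (\<rho> / 2)"]
    by (simp add: algebra_simps)
  ultimately show ?thesis using two_inner_diff_psd[OF Ht, of x x'] by linarith
qed

text \<open>The one-step estimate in real arithmetic: \<open>g1\<close> and \<open>gv\<close> stand
  for finite values of \<open>g\<close>, and the conjugate values are replaced by their
  Fenchel-Young expressions. Hypothesis \<open>v1\<close> is strong convexity along the subgradient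
  produced by the \<open>v\<close>-update.\<close>

lemma admm_step:
  fixes \<phi> :: "real^'n \<Rightarrow> real" and A :: "real^'n^'p" and B :: "real^'m^'p"
    and G :: "real^'m^'m" and Ht :: "real^'p^'p"
    and w w0 w1 :: "real^'n" and v v0 v1 :: "real^'m" and \<alpha> \<alpha>0 \<alpha>1 \<alpha>t c :: "real^'p"
    and \<gamma> lam \<rho> s \<theta> g1 gv :: real
  assumes pos: "0 < \<gamma>" "0 < \<rho>" "0 < \<theta>" "0 \<le> s" "s < 1"
    and \<phi>: "convex_on UNIV \<phi>" "smooth_fun (1 / \<gamma>) \<phi>"
    and psd: "pos_semidef G" "pos_semidef H" "pos_semidef Ht"
    and H: "H = transpose A ** Ht ** A"
    and \<theta>1: "\<theta> * (\<gamma> * max_eigenvalue H + 1) \<le> \<gamma> * \<rho> * (sigma_min A)\<^sup>2"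
    and \<theta>2: "\<theta> * max_eigenvalue Ht \<le> s * \<rho>"
    and \<theta>3: "\<theta> * ((\<rho> + max_eigenvalue Ht) * (max_singular_value B)\<^sup>2
        + (1 - s) * \<rho> * max_singular_value G) \<le> (1 - s) * lam"
    and w1: "GDERIV \<phi> w1 :> - (transpose A *v \<alpha>t)" and w: "GDERIV \<phi> w :> - (transpose A *v \<alpha>)"
    and v1: "g1 + - (transpose B *v (- \<alpha>0 + \<rho> *\<^sub>R (B *v v1 - (A *v w0 - c))) + \<rho> *\<^sub>R (G *v (v1 - v0)))
        \<bullet> (v - v1) + lam / 2 * (norm (v1 - v))\<^sup>2 \<le> gv"
    and \<alpha>1: "\<alpha>1 = \<alpha>0 + \<rho> *\<^sub>R (A *v w1 - B *v v1 - c)"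
    and \<alpha>t: "\<alpha>t = \<alpha>1 + Ht *v (A *v (w1 - w0))"
  defines "\<delta> \<equiv> \<lambda>w' v' \<alpha>'. \<rho> / 2 * (norm (A *v w' - B *v v - c))\<^sup>2
      + 1 / 2 * norm_sq_wrt Ht (A *v w' - B *v v - c)
      + \<rho> * (1 + \<theta>) / 2 * norm_sq_wrt G (v' - v)
      + (1 + \<theta>) / (2 * \<rho>) * (norm (\<alpha> - \<alpha>'))\<^sup>2"
  shows "\<phi> w1 + g1 - \<phi> w - gv - \<alpha>t \<bullet> (A *v w - B *v v - c) + \<alpha> \<bullet> (A *v w1 - B *v v1 - c)
      \<le> \<delta> w0 v0 \<alpha>0 / (1 + \<theta>) - \<delta> w1 v1 \<alpha>1" (is "?r \<le> ?R")
    and "(- (\<alpha>t \<bullet> (A *v w1)) - \<phi> w1) + g1 - (- (\<alpha> \<bullet> (A *v w)) - \<phi> w) - gv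
      + \<alpha>t \<bullet> (B *v v + c) - \<alpha> \<bullet> (B *v v1 + c)
      \<le> \<delta> w0 v0 \<alpha>0 / (1 + \<theta>) - \<delta> w1 v1 \<alpha>1" (is "?r' \<le> ?R")
proof -
  define x where "x = A *v w1 - B *v v - c"
  define x' where "x' = A *v w0 - B *v v - c"
  define e where "e = v1 - v"
  define e' where "e' = v0 - v"
  define y where "y = B *v e"
  define a where "a = \<alpha>1 - \<alpha>"
  define a' where "a' = \<alpha>0 - \<alpha>"
  define u where "u = w1 - w0"
  define N where "N = (norm (transpose A *v a + H *v u))\<^sup>2"
  define S where "S = - (a \<bullet> (x - y)) - x \<bullet> (Ht *v (x - x')) - \<rho> * ((x - x') \<bullet> y)
      - \<rho> * (e \<bullet> (G *v (e - e')))"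
  have y: "y = B *v v1 - B *v v" by (simp add: y_def e_def matrix_vector_mult_diff_distrib)
  have xy: "x - y = A *v w1 - B *v v1 - c" by (simp add: x_def y)
  have aa: "a - a' = \<rho> *\<^sub>R (x - y)" by (simp add: a_def a'_def \<alpha>1 xy)
  have Au: "A *v u = x - x'" by (simp add: u_def x_def x'_def matrix_vector_mult_diff_distrib)
  have Hu: "H *v u = transpose A *v (Ht *v (A *v u))" by (simp only: H matrix_vector_mul_assoc matrix_mul_assoc)
  have \<alpha>t': "\<alpha>t = \<alpha>1 + Ht *v (x - x')" using \<alpha>t Au by (simp only: u_def)
  have adj: "- (transpose A *v b) \<bullet> z = - (b \<bullet> (A *v z))" for b z
    using inner_matrix_left[of "transpose A" b z] by (simp only: transpose_transpose inner_minus_left)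
  \<comment> \<open>The factorization of \<open>H\<close> makes \<open>H *v u\<close> the image
    under \<open>transpose A\<close> of the dual shift, so \<open>N\<close> is the squared distance
    between the gradients of \<phi> at \<open>w1\<close> and \<open>w\<close>.\<close>
  have N: "N = (norm (transpose A *v \<alpha>t - transpose A *v \<alpha>))\<^sup>2"
  proof -
    have "transpose A *v a + H *v u = transpose A *v (\<alpha>t - \<alpha>)"
      unfolding Hu Au \<alpha>t' a_def by (simp only: matrix_vector_right_distrib[symmetric] add_diff_eq diff_add_eq)
    then show ?thesis by (simp only: N_def matrix_vector_mult_diff_distrib)
  qed
  have \<alpha>tx: "\<alpha>t \<bullet> x = \<alpha>1 \<bullet> x + x \<bullet> (Ht *v (x - x'))"
    unfolding \<alpha>t' by (simp only: inner_add_left inner_commute[of x])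

  have g: "g1 - gv \<le> \<alpha>1 \<bullet> y - \<rho> * ((x - x') \<bullet> y) - \<rho> * (e \<bullet> (G *v (e - e'))) - lam / 2 * (norm e)\<^sup>2"
  proof -
    \<comment> \<open>The \<open>v\<close>-update sees the old \<open>w0\<close>; passing to the new
      multiplier \<open>\<alpha>1\<close> costs the term in \<open>x - x'\<close>.\<close>
    have "- \<alpha>0 + \<rho> *\<^sub>R (B *v v1 - (A *v w0 - c)) = - \<alpha>1 + \<rho> *\<^sub>R (x - x')"
      by (simp add: \<alpha>1 x_def x'_def algebra_simps)
    moreover have "v - v1 = - e" "v1 - v0 = e - e'" by (simp_all add: e_def e'_def)
    moreover have "(transpose B *v b) \<bullet> e = b \<bullet> y" for b
      using inner_matrix_left[of "transpose B" b e] by (simp only: transpose_transpose y_def)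
    ultimately have "g1 + ((- \<alpha>1 + \<rho> *\<^sub>R (x - x')) \<bullet> y + \<rho> * ((G *v (e - e')) \<bullet> e))
        + lam / 2 * (norm e)\<^sup>2 \<le> gv"
      using v1 by (simp only: inner_minus_right inner_minus_left minus_minus inner_add_left
          inner_scaleR_left e_def[symmetric])
    then show ?thesis
      unfolding inner_add_left inner_scaleR_left inner_minus_left inner_commute[of e] by linarith
  qed
  \<comment> \<open>For the first gap the tangent is taken at \<open>w1\<close> and tested at
    \<open>w\<close>.\<close>
  have "\<phi> w1 - \<alpha>t \<bullet> (A *v w - A *v w1) + \<gamma> / 2 * N \<le> \<phi> w"
    using smooth_convex_lower_bound[OF pos(1) \<phi> w1 w]
    unfolding adj N matrix_vector_mult_diff_distrib by (simp add: norm_minus_commute)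
  then have r: "?r \<le> S - \<gamma> / 2 * N - lam / 2 * (norm e)\<^sup>2"
    using g \<alpha>tx unfolding xy[symmetric] S_def a_def x_def
    by (simp add: inner_diff_left inner_diff_right)
  \<comment> \<open>For the second gap the roles of \<open>w\<close> and \<open>w1\<close> are
    exchanged; the cocoercivity term is symmetric and stays the same.\<close>
  have "\<phi> w - \<alpha> \<bullet> (A *v w1 - A *v w) + \<gamma> / 2 * N \<le> \<phi> w1"
    using smooth_convex_lower_bound[OF pos(1) \<phi> w w1]
    unfolding adj N matrix_vector_mult_diff_distrib by (simp add: norm_minus_commute)
  then have r': "?r' \<le> S - \<gamma> / 2 * N - lam / 2 * (norm e)\<^sup>2"
    using g \<alpha>tx unfolding S_def a_def x_def y
    by (simp add: inner_diff_left inner_diff_right inner_add_right)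

  have dual: "\<theta> / \<rho> * (norm a)\<^sup>2 \<le> \<gamma> * N + norm_sq_wrt Ht (x - x')"
  proof -
    have "u \<bullet> (H *v u) = norm_sq_wrt Ht (x - x')"
      using inner_matrix_left[of A u "Ht *v (A *v u)"] by (simp only: Hu norm_sq_wrt_def Au)
    then show ?thesis
      using dual_error_bound[OF pos(1,2) psd(2) \<theta>1, of a u] by (simp only: N_def)
  qed
  have primal: "\<theta> / (1 + \<theta>) * (\<rho> * (norm x')\<^sup>2 + norm_sq_wrt Ht x') + \<theta> * \<rho> * norm_sq_wrt G e
      \<le> \<rho> * (norm (x' - y))\<^sup>2 + lam * (norm e)\<^sup>2"
    unfolding y_def using primal_error_bound[OF pos(2-5) psd(1,3) \<theta>2 \<theta>3] .
  \<comment> \<open>\<open>U / 2\<close> is what division by \<open>1 + \<theta>\<close> removes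
    from the terms of the old potential that lack this factor.\<close>
  define U where "U = \<theta> / (1 + \<theta>) * (\<rho> * (norm x')\<^sup>2 + norm_sq_wrt Ht x')"
  define E where "E = (\<rho> / 2 * (norm x')\<^sup>2 + norm_sq_wrt Ht x' / 2 + \<rho> / 2 * norm_sq_wrt G e' + (norm a')\<^sup>2 / (2 * \<rho>))
      - (\<rho> / 2 * (norm x)\<^sup>2 + norm_sq_wrt Ht x / 2 + \<rho> / 2 * norm_sq_wrt G e + (norm a)\<^sup>2 / (2 * \<rho>))"
  have "0 \<le> \<rho> / 2 * norm_sq_wrt G (e - e')"
    using psd(1) pos(2) by (simp add: norm_sq_wrt_def pos_semidef_def)
  then have S: "S \<le> E - \<rho> * (norm (x' - y))\<^sup>2 / 2 - norm_sq_wrt Ht (x - x') / 2"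
    using step_identity[OF pos(2) psd(1,3) aa, of x' e e'] unfolding S_def E_def by simp
  \<comment> \<open>In the old potential the factor cancels on the \<open>G\<close> and dual terms;
    in the new one its excess \<theta> leaves the last two subtracted terms, to be absorbed by
    \<open>primal\<close> and \<open>dual\<close>.\<close>
  have R: "?R = E - U / 2 - \<theta> * \<rho> * norm_sq_wrt G e / 2 - \<theta> / \<rho> * (norm a)\<^sup>2 / 2"
  proof -
    have "\<delta> w0 v0 \<alpha>0 / (1 + \<theta>) = \<rho> / 2 * (norm x')\<^sup>2 + norm_sq_wrt Ht x' / 2
        - U / 2 + \<rho> / 2 * norm_sq_wrt G e' + (norm a')\<^sup>2 / (2 * \<rho>)"
    proof -
      define P where "P = \<rho> / 2 * (norm x')\<^sup>2 + 1 / 2 * norm_sq_wrt Ht x'"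
      have "\<delta> w0 v0 \<alpha>0 / (1 + \<theta>) =
          (P + (1 + \<theta>) * (\<rho> / 2 * norm_sq_wrt G e' + (norm a')\<^sup>2 / (2 * \<rho>))) / (1 + \<theta>)"
        unfolding \<delta>_def x'_def[symmetric] e'_def[symmetric] a'_def norm_minus_commute[of \<alpha>] P_def
        by (rule arg_cong[where f = "\<lambda>z. z / (1 + \<theta>)"]) (simp add: algebra_simps add_divide_distrib)
      also have "\<dots> = P / (1 + \<theta>) + (\<rho> / 2 * norm_sq_wrt G e' + (norm a')\<^sup>2 / (2 * \<rho>))"
        using pos by (simp add: add_divide_distrib[of P])
      also have "P / (1 + \<theta>) = P - \<theta> / (1 + \<theta>) * P" using pos by (simp add: field_simps)
      also have "\<theta> / (1 + \<theta>) * P = U / 2"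
        by (simp add: P_def U_def field_simps)
      finally show ?thesis by (simp add: P_def)
    qed
    moreover have "\<delta> w1 v1 \<alpha>1 = \<rho> / 2 * (norm x)\<^sup>2 + norm_sq_wrt Ht x / 2 + \<rho> / 2 * norm_sq_wrt G e
        + (norm a)\<^sup>2 / (2 * \<rho>) + \<theta> * \<rho> * norm_sq_wrt G e / 2 + \<theta> / \<rho> * (norm a)\<^sup>2 / 2"
      using pos unfolding \<delta>_def x_def[symmetric] e_def[symmetric] a_def norm_minus_commute[of \<alpha>]
      by (simp add: field_simps)
    ultimately show ?thesis unfolding E_def by linarith
  qed
  have "S - \<gamma> / 2 * N - lam / 2 * (norm e)\<^sup>2 \<le> ?R"
  proof -
    \<comment> \<open>All nonlinear terms are abstracted to real variables, so that the combination
      is purely linear.\<close>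
    have "S' - n / 2 - m / 2 \<le> E - U / 2 - V / 2 - W / 2"
      if "S' \<le> E - z / 2 - h / 2" "W \<le> n + h" "U + V \<le> z + m" for S' n m V W z h :: real
      using that by linarith
    from this[OF S dual primal[folded U_def]] show ?thesis unfolding R by simp
  qed
  then show "?r \<le> ?R" "?r' \<le> ?R" using r r' by simp_all
qed

section \<open>Clearing the step-size quotients and telescoping\<close>

lemma le_quot_or_topD:
  assumes "ereal t \<le> quot_or_top a b" "0 \<le> a" "0 \<le> b"
  shows "t * b \<le> a"
  using assms by (auto simp: quot_or_top_def pos_le_divide_eq split: if_splits)

theorem theorem3p1:
  fixes \<phi> :: "real^'n \<Rightarrow> real"
    and g :: "real^'m \<Rightarrow> ereal"
    and A :: "real^'n^'p" and B :: "real^'m^'p" and c :: "real^'p"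
    and G :: "real^'m^'m" and H :: "real^'n^'n" and Ht :: "real^'p^'p"
    and \<gamma> lam \<rho> s \<theta> :: real
    and vs :: "nat \<Rightarrow> real^'m" and ws :: "nat \<Rightarrow> real^'n" and \<alpha>s :: "nat \<Rightarrow> real^'p"
    and \<alpha> :: "real^'p" and v :: "real^'m" and w :: "real^'n" and T :: nat
  assumes "0 < \<gamma>" and "0 < lam" and "0 < \<rho>"
    and "convex_on UNIV \<phi>" and "smooth_fun (1 / \<gamma>) \<phi>"
    and "proper_fun g" and "convex_ereal g" and "strongly_convex lam g"
    and "pos_semidef G" and "pos_semidef H" and "pos_semidef Ht"
    and "H = transpose A ** Ht ** A"
    and "0 \<le> s" and "s < 1" and "0 < \<theta>"
    and "ereal \<theta> \<le>
      min (quot_or_top (\<gamma> * \<rho> * (sigma_min A)\<^sup>2) (\<gamma> * max_eigenvalue H + 1))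
        (min (quot_or_top (s * \<rho>) (max_eigenvalue Ht))
          (quot_or_top ((1 - s) * lam)
            ((\<rho> + max_eigenvalue Ht) * (max_singular_value B)\<^sup>2
              + (1 - s) * \<rho> * max_singular_value G)))"
    and "admm \<phi> g A B c \<rho> G H vs ws \<alpha>s"
    and "w \<in> subdifferential (conjugate (\<lambda>u. ereal (\<phi> u))) (- (transpose A *v \<alpha>))"
    and "1 \<le> T"
  shows
    "let conj\<phi> = conjugate (\<lambda>u. ereal (\<phi> u));
         \<alpha>t = (\<lambda>t. \<alpha>s t + Ht *v (A *v (ws t - ws (t - 1))));
         r = (\<lambda>t. ereal (\<phi> (ws t)) + g (vs t) - ereal (\<phi> w) - g v
                - ereal (\<alpha>t t \<bullet> (A *v w - B *v v - c))
                + ereal (\<alpha> \<bullet> (A *v ws t - B *v vs t - c)));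
         r' = (\<lambda>t. conj\<phi> (- (transpose A *v \<alpha>t t)) + g (vs t)
                - conj\<phi> (- (transpose A *v \<alpha>)) - g v
                + ereal (\<alpha>t t \<bullet> (B *v v + c))
                - ereal (\<alpha> \<bullet> (B *v vs t + c)));
         \<delta> = (\<lambda>t. \<rho> / 2 * (norm (A *v ws t - B *v v - c))\<^sup>2
                + 1 / 2 * norm_sq_wrt Ht (A *v ws t - B *v v - c)
                + \<rho> * (1 + \<theta>) / 2 * norm_sq_wrt G (vs t - v)
                + (1 + \<theta>) / (2 * \<rho>) * (norm (\<alpha> - \<alpha>s t))\<^sup>2)
     in (\<Sum>t=1..T. ereal ((1 + \<theta>) powi (int t - int T)) * r t)
            \<le> ereal ((1 + \<theta>) powi (- int T) * \<delta> 0 - \<delta> T)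
      \<and> (\<Sum>t=1..T. ereal ((1 + \<theta>) powi (int t - int T)) * r' t)
            \<le> ereal ((1 + \<theta>) powi (- int T) * \<delta> 0 - \<delta> T)"
proof -
  note psd = \<open>pos_semidef G\<close> \<open>pos_semidef H\<close> \<open>pos_semidef Ht\<close>
  have \<theta>: "0 < \<theta>" and s: "0 \<le> s" "s < 1" and pos: "0 < \<gamma>" "0 < lam" "0 < \<rho>" by fact+
  have H0: "0 \<le> max_eigenvalue H" and Ht0: "0 \<le> max_eigenvalue Ht"
    using psd(2,3) eigenvalues_nonneg max_eigenvalue(1) pos_semidef_def by blast+
  \<comment> \<open>With a zero denominator the cleared inequality only says that the numerator is
    nonnegative, so the convention \<open>\<infinity>\<close> loses nothing.\<close>
  have \<theta>1: "\<theta> * (\<gamma> * max_eigenvalue H + 1) \<le> \<gamma> * \<rho> * (sigma_min A)\<^sup>2"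
    and \<theta>2: "\<theta> * max_eigenvalue Ht \<le> s * \<rho>"
    and \<theta>3: "\<theta> * ((\<rho> + max_eigenvalue Ht) * (max_singular_value B)\<^sup>2
        + (1 - s) * \<rho> * max_singular_value G) \<le> (1 - s) * lam"
    using assms(16) pos s H0 Ht0 max_singular_value(1)[of G] by (auto intro!: le_quot_or_topD)

  let ?conj = "conjugate (\<lambda>u. ereal (\<phi> u))"
  define \<alpha>t where "\<alpha>t = (\<lambda>t. \<alpha>s t + Ht *v (A *v (ws t - ws (t - 1))))"
  define r where "r = (\<lambda>t. ereal (\<phi> (ws t)) + g (vs t) - ereal (\<phi> w) - g v
                - ereal (\<alpha>t t \<bullet> (A *v w - B *v v - c))
                + ereal (\<alpha> \<bullet> (A *v ws t - B *v vs t - c)))"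
  define r' where "r' = (\<lambda>t. ?conj (- (transpose A *v \<alpha>t t)) + g (vs t)
                - ?conj (- (transpose A *v \<alpha>)) - g v
                + ereal (\<alpha>t t \<bullet> (B *v v + c))
                - ereal (\<alpha> \<bullet> (B *v vs t + c)))"
  define \<delta> where "\<delta> = (\<lambda>t. \<rho> / 2 * (norm (A *v ws t - B *v v - c))\<^sup>2
                + 1 / 2 * norm_sq_wrt Ht (A *v ws t - B *v v - c)
                + \<rho> * (1 + \<theta>) / 2 * norm_sq_wrt G (vs t - v)
                + (1 + \<theta>) / (2 * \<rho>) * (norm (\<alpha> - \<alpha>s t))\<^sup>2)"

  have grad: "\<exists>d. GDERIV \<phi> x :> d" for x
    using \<open>smooth_fun (1 / \<gamma>) \<phi>\<close> by (simp add: smooth_fun_def)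
  \<comment> \<open>Both conjugate values in \<open>r'\<close> are taken at gradients of \<phi>,
    hence are finite and explicit.\<close>
  have conj: "?conj (- (transpose A *v b)) = ereal (- (b \<bullet> (A *v x)) - \<phi> x)"
    if "GDERIV \<phi> x :> - (transpose A *v b)" for x b
    using conjugate_at_subgradient[OF convex_above_gradient[OF \<open>convex_on UNIV \<phi>\<close> that]]
      inner_matrix_left[of "transpose A" b x] by (simp only: transpose_transpose inner_minus_left)
  have w: "GDERIV \<phi> w :> - (transpose A *v \<alpha>)"
    using grad[of w] gderiv_if_conjugate_subgradient[OF \<open>convex_on UNIV \<phi>\<close> _ assms(18)] by metis

  have step: "r t \<le> ereal (\<delta> (t - 1) / (1 + \<theta>) - \<delta> t) \<and> r' t \<le> ereal (\<delta> (t - 1) / (1 + \<theta>) - \<delta> t)"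
    if t: "t \<ge> 1" for t
  proof -
    note admm = \<open>admm \<phi> g A B c \<rho> G H vs ws \<alpha>s\<close>[unfolded admm_def, rule_format, OF t]
    \<comment> \<open>Fits \<open>prox_minimizer_subgradient\<close> with matrix \<open>B\<close>,
      linear term \<open>- \<alpha>s (t - 1)\<close> and center \<open>A *v ws (t - 1) - c\<close>,
      after a sign flip inside the norm.\<close>
    have minv: "is_arg_min (\<lambda>v. g v + ereal (- \<alpha>s (t - 1) \<bullet> (B *v v)
          + \<rho> / 2 * (norm (B *v v - (A *v ws (t - 1) - c)))\<^sup>2 + \<rho> / 2 * norm_sq_wrt G (v - vs (t - 1))))
        (\<lambda>_. True) (vs t)"
    proof -
      have norm_eq: "norm (A *v ws (t - 1) - B *v v - c) = norm (B *v v - (A *v ws (t - 1) - c))" for v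
        by (subst norm_minus_commute) (simp add: algebra_simps)
      show ?thesis using admm[THEN conjunct1] by (simp only: norm_eq inner_minus_left)
    qed
    have minw: "is_arg_min (\<lambda>w. ereal (\<phi> w) + ereal (\<alpha>s (t - 1) \<bullet> (A *v w)
          + \<rho> / 2 * (norm (A *v w - (B *v vs t + c)))\<^sup>2 + 1 / 2 * norm_sq_wrt H (w - ws (t - 1))))
        (\<lambda>_. True) (ws t)"
      using admm[THEN conjunct2, THEN conjunct1]
      by (simp only: is_arg_min_def diff_diff_eq add.assoc plus_ereal.simps less_ereal.simps simp_thms)
    have \<alpha>s: "\<alpha>s t = \<alpha>s (t - 1) + \<rho> *\<^sub>R (A *v ws t - B *v vs t - c)"
      using admm by blast

    have w1: "GDERIV \<phi> (ws t) :> - (transpose A *v \<alpha>t t)"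
    proof -
      have "proper_fun (\<lambda>x. ereal (\<phi> x))" by (simp add: proper_fun_def)
      then have "- (transpose A *v (\<alpha>s (t - 1) + \<rho> *\<^sub>R (A *v ws t - (B *v vs t + c)))
          + 1 *\<^sub>R (H *v (ws t - ws (t - 1)))) \<in> subdifferential (\<lambda>x. ereal (\<phi> x)) (ws t)"
        using convex_ereal_real[OF \<open>convex_on UNIV \<phi>\<close>] psd(2) minw by (rule prox_minimizer_subgradient)
      also have "\<alpha>s (t - 1) + \<rho> *\<^sub>R (A *v ws t - (B *v vs t + c)) = \<alpha>s t"
        by (simp only: \<alpha>s diff_diff_eq)
      \<comment> \<open>Factoring \<open>H\<close> through \<open>transpose A\<close> merges the
        proximal term with the multiplier into the shifted dual variable.\<close>
      also have "transpose A *v \<alpha>s t + 1 *\<^sub>R (H *v (ws t - ws (t - 1))) = transpose A *v \<alpha>t t"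
        by (simp only: \<alpha>t_def \<open>H = transpose A ** Ht ** A\<close> matrix_vector_right_distrib
            matrix_vector_mul_assoc matrix_mul_assoc scaleR_one)
      finally have "\<phi> (ws t) + - (transpose A *v \<alpha>t t) \<bullet> (y - ws t) \<le> \<phi> y" for y
        by (simp add: subdifferential_def)
      then show ?thesis using grad[of "ws t"] gderiv_eq_subgradient by metis
    qed

    define d where "d = - (transpose B *v (- \<alpha>s (t - 1) + \<rho> *\<^sub>R (B *v vs t - (A *v ws (t - 1) - c)))
        + \<rho> *\<^sub>R (G *v (vs t - vs (t - 1))))"
    have d: "d \<in> subdifferential g (vs t)"
      unfolding d_def using \<open>proper_fun g\<close> \<open>convex_ereal g\<close> psd(1) minv
      by (rule prox_minimizer_subgradient)
    then obtain g1 where g1: "g (vs t) = ereal g1"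
      by (cases "g (vs t)") (auto simp: subdifferential_def)
    have sc: "ereal (lam / 2 * (norm (vs t - v))\<^sup>2) \<le> g v - ereal g1 - ereal (d \<bullet> (v - vs t))"
      using \<open>strongly_convex lam g\<close> d unfolding strongly_convex_def bregman_def g1[symmetric] by blast
    show ?thesis
    proof (cases "g v")
      case (real gv)
      have "g1 + d \<bullet> (v - vs t) + lam / 2 * (norm (vs t - v))\<^sup>2 \<le> gv"
        using sc by (simp add: real)
      note bounds = admm_step[OF pos(1,3) \<theta> s \<open>convex_on UNIV \<phi>\<close> \<open>smooth_fun (1 / \<gamma>) \<phi>\<close> psd
          \<open>H = transpose A ** Ht ** A\<close> \<theta>1 \<theta>2 \<theta>3 w1 w this[unfolded d_def] \<alpha>s \<alpha>t_def[THEN fun_cong]]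
      show ?thesis
        using bounds unfolding r_def r'_def \<delta>_def g1 real conj[OF w] conj[OF w1] by simp
    next
      \<comment> \<open>Both gaps are \<open>- \<infinity>\<close> here.\<close>
      case PInf
      then show ?thesis unfolding r_def r'_def g1 conj[OF w] conj[OF w1] by simp
    next
      case MInf
      then show ?thesis using \<open>proper_fun g\<close> by (simp add: proper_fun_def)
    qed
  qed

  have telescope: "(\<Sum>t=1..T. ereal ((1 + \<theta>) powi (int t - int T)) * q t)
      \<le> ereal ((1 + \<theta>) powi (- int T) * \<delta> 0 - \<delta> T)"
    if q: "\<And>t. t \<ge> 1 \<Longrightarrow> q t \<le> ereal (\<delta> (t - 1) / (1 + \<theta>) - \<delta> t)" for q
  proof -
    \<comment> \<open>With these weights, division by \<open>1 + \<theta>\<close> is the shift from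
      \<open>t\<close> to \<open>t - 1\<close>, so each weighted bound is a difference of
      consecutive values of \<open>f\<close>, and \<open>f T = \<delta> T\<close>.\<close>
    define f where "f = (\<lambda>t. (1 + \<theta>) powi (int t - int T) * \<delta> t)"
    have "(\<Sum>t=1..T. ereal ((1 + \<theta>) powi (int t - int T)) * q t) \<le> (\<Sum>t=1..T. ereal (f (t - 1) - f t))"
    proof (rule sum_mono)
      fix t assume "t \<in> {1..T}"
      then have t: "t \<ge> 1" by simp
      have "(1 + \<theta>) powi (int (t - 1) - int T) = (1 + \<theta>) powi ((int t - int T) - 1)"
        using t by (simp add: of_nat_diff algebra_simps)
      also have "\<dots> = (1 + \<theta>) powi (int t - int T) / (1 + \<theta>)"
        using \<theta> by (subst power_int_diff) auto
      finally have "f (t - 1) - f t = (1 + \<theta>) powi (int t - int T) * (\<delta> (t - 1) / (1 + \<theta>) - \<delta> t)"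
        by (simp add: f_def right_diff_distrib)
      then show "ereal ((1 + \<theta>) powi (int t - int T)) * q t \<le> ereal (f (t - 1) - f t)"
        using ereal_mult_left_mono[OF q[OF t], of "ereal ((1 + \<theta>) powi (int t - int T))"] \<theta> by simp
    qed
    also have "\<dots> = ereal (\<Sum>t=1..T. f (t - 1) - f t)" by simp
    also have "(\<Sum>t=1..T. f (t - 1) - f t) = f 0 - f T"
      using sum_telescope''[of 0 T f] sum_negf[of "\<lambda>t. f t - f (t - 1)" "{Suc 0..T}"] by simp
    finally show ?thesis by (simp add: f_def)
  qed
  show ?thesis
    unfolding Let_def \<alpha>t_def[symmetric]
    using telescope[of r] telescope[of r'] step
    by (simp add: r_def r'_def \<delta>_def \<alpha>t_def)
qed

end
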